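(* The $k$-splits of $\Delta_{d-1}\times\Delta_{\ell-1}$ are in bijection with collections of $k$ pairs $(A_1,B_1),\ldots,(A_k,B_k)$, such that $A_1,\ldots,A_k$ is a partition of $[d]$ and $B_1,\ldots,B_k$ is a partition of $[\ell]$. In particular, the number of $k$-splits of $\Delta_{d-1}\times\Delta_{\ell-1}$ equals $$\frac1k\left(\sum_{\alpha_1=1}^{\beta_1-(k-1)}\cdots\sum_{\alpha_{k-1}=1}^{\beta_{k-1}-1}\ \prod_{j=1}^{k-1}\binom{\beta_j}{\alpha_j}\right)\cdot\left(\sum_{\gamma_1=1}^{\delta_1-(k-1)}\cdots\sum_{\gamma_{k-1}=1}^{\delta_{k-1}-1}\ \prod_{j=1}^{k-1}\binom{\delta_j}{\gamma_j}\right),$$ where $\beta_i=d-\sum_{j=1}^{i-1}\alpha_j$ and $\delta_i=\ell-\sum_{j=1}^{i-1}\gamma_j$.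
   Context: $[m]=\{1,\ldots,m\}$, and $\Delta_{m-1}=\{x\in[0,1]^m:\sum_i x_i=1\}$ is the $(m-1)$-simplex. A subdivision of a polytope (on its vertex set) is coarsest if it is non-trivial and the only strictly coarser subdivision is the trivial one. A $k$-split of a polytope is a coarsest subdivision with $k$ maximal cells and a common cell of codimension $k-1$.
   Formalization: The common cell of a k-split is required to meet the relative interior of the polytope, k is at least 2, and collections of k pairs are taken as lists up to cyclic rotation; without these the claimed bijection or count fails. *)

theory Defs
  imports "HOL-Analysis.Analysis" "HOL-Library.Disjoint_Sets"
begin

section \<open>Polytopal subdivisions and k-splits\<close>

definition verts :: "'a::euclidean_space set \<Rightarrow> 'a set" where
  "verts P = {x. x extreme_point_of P}"

text \<open>
  A subdivision is the set of all its cells, of every dimension; the empty cell belongs to it,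
  because \<^const>\<open>face_of\<close> admits the empty face.
\<close>

definition subdivision_of :: "'a::euclidean_space set set \<Rightarrow> 'a set \<Rightarrow> bool" where
  "subdivision_of S P \<longleftrightarrow>
     finite S \<and>
     (\<forall>C\<in>S. polytope C \<and> verts C \<subseteq> verts P) \<and>
     (\<forall>C\<in>S. \<forall>F. F face_of C \<longrightarrow> F \<in> S) \<and>
     (\<forall>C\<in>S. \<forall>D\<in>S. C \<inter> D face_of C \<and> C \<inter> D face_of D) \<and>
     \<Union>S = P"

definition trivial_subdivision :: "'a::euclidean_space set \<Rightarrow> 'a set set" where
  "trivial_subdivision P = {F. F face_of P}"

definition strictly_coarser :: "'a::euclidean_space set set \<Rightarrow> 'a set set \<Rightarrow> bool" where
  "strictly_coarser T S \<longleftrightarrow> T \<noteq> S \<and> (\<forall>C\<in>S. \<exists>D\<in>T. C \<subseteq> D)"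

definition coarsest_subdivision :: "'a::euclidean_space set set \<Rightarrow> 'a set \<Rightarrow> bool" where
  "coarsest_subdivision S P \<longleftrightarrow>
     subdivision_of S P \<and> S \<noteq> trivial_subdivision P \<and>
     (\<forall>T. subdivision_of T P \<and> strictly_coarser T S \<longrightarrow> T = trivial_subdivision P)"

definition maximal_cells :: "'a set set \<Rightarrow> 'a set set" where
  "maximal_cells S = {C \<in> S. \<forall>D\<in>S. C \<subseteq> D \<longrightarrow> D = C}"

text \<open>
  The common cell of a k-split is an inner cell, i.e. it is not contained in the boundary of the
  polytope. This is not automatic for a coarsest subdivision whose k maximal cells share a cell of
  codimension k - 1. In the product of a 2-simplex and a 3-simplex, with ij denoting the
  vertex (e_i, e_j), the four maximal cells with vertex sets
    {11,13,21,22,31,32,33,34}, {13,21,22,23,24,33,34}, {11,12,13,14,22,32,34},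
    {11,13,14,21,22,24,34}
  form a coarsest subdivision, and they share the triangle {13,22,34}, which has codimension 3
  but lies in the boundary.
\<close>

definition k_split :: "nat \<Rightarrow> 'a::euclidean_space set set \<Rightarrow> 'a set \<Rightarrow> bool" where
  "k_split k S P \<longleftrightarrow>
     coarsest_subdivision S P \<and>
     card (maximal_cells S) = k \<and>
     (\<exists>H\<in>S. (\<forall>C\<in>maximal_cells S. H \<subseteq> C) \<and>
            H \<inter> rel_interior P \<noteq> {} \<and>
            aff_dim H = aff_dim P - (int k - 1))"


section \<open>Products of simplices\<close>

text \<open>The simplex of dimension m - 1 with m = \<open>CARD('m)\<close>; the type \<open>'m\<close> plays the role of [m].\<close>

definition unit_simplex :: "(real ^ 'm) set" where
  "unit_simplex = {x. (\<forall>i. x $ i \<in> {0..1}) \<and> (\<Sum>i\<in>UNIV. x $ i) = 1}"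

definition simplex_product :: "((real ^ 'd) \<times> (real ^ 'l)) set" where
  "simplex_product = unit_simplex \<times> unit_simplex"


section \<open>Collections of pairs of parts\<close>

definition is_partition :: "'a set list \<Rightarrow> bool" where
  "is_partition As \<longleftrightarrow> distinct As \<and> partition_on UNIV (set As)"

definition pair_lists :: "nat \<Rightarrow> ('d set \<times> 'l set) list set" where
  "pair_lists k = {xs. length xs = k \<and> is_partition (map fst xs) \<and> is_partition (map snd xs)}"

text \<open>
  The pairs of a collection are ordered cyclically. Since there are as many lists of k pairs as
  there are pairs of ordered partitions, and all k rotations of such a list are distinct, this
  accounts for the factor 1/k in the number of k-splits. For k = 2 cyclic order carries no
  information; for larger k every unordered collection has (k - 1)! cyclic orders.
\<close>

definition cyclic_class :: "'a list \<Rightarrow> 'a list set" where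
  "cyclic_class xs = {rotate n xs | n. True}"

definition pair_collections :: "nat \<Rightarrow> ('d set \<times> 'l set) list set set" where
  "pair_collections k = cyclic_class ` pair_lists k"


section \<open>The iterated binomial sum\<close>

definition remaining :: "nat \<Rightarrow> (nat \<Rightarrow> nat) \<Rightarrow> nat \<Rightarrow> nat" where
  "remaining m a i = m - (\<Sum>j = 1..<i. a j)"

text \<open>
  The iterated sum is written as one sum over the tuples of its summation indices. Truncated
  subtraction does no harm: where a difference would be negative, the range of the corresponding
  index is empty in either reading.
\<close>

definition sum_indices :: "nat \<Rightarrow> nat \<Rightarrow> (nat \<Rightarrow> nat) set" where
  "sum_indices m k =
     {a \<in> {1..k-1} \<rightarrow>\<^sub>E UNIV. \<forall>j\<in>{1..k-1}. a j \<in> {1..remaining m a j - (k - j)}}"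

definition iterated_binomial_sum :: "nat \<Rightarrow> nat \<Rightarrow> nat" where
  "iterated_binomial_sum m k =
     (\<Sum>a\<in>sum_indices m k. \<Prod>j = 1..k-1. remaining m a j choose a j)"

end

theory Submission
  imports Defs
begin

text \<open>
  Write \<open>V ij = (e_i, e_j)\<close> for the vertices of the product \<open>P\<close> of the two simplices. Labellings
  \<open>\<alpha>\<close>, \<open>\<beta>\<close> of the two index sets by \<open>{0, \<dots>, k-1}\<close> give the heights
  \<open>u_q (x, y) = x(\<alpha> < q) - y(\<beta> < q)\<close>, and the cells on which a given \<open>u_r\<close> is minimal form a \<open>k\<close>-split.
  In the cell of \<open>r\<close> the mass of \<open>x\<close> comes before the mass of \<open>y\<close>, in the cyclic order of the labels
  started at \<open>r\<close>; so one can peel off vertices as in a monotone coupling, and the vertices of the cell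
  are those \<open>V ij\<close> for which \<open>\<alpha> i\<close> comes before \<open>\<beta> j\<close>.

  Conversely, let \<open>H\<close> be the common cell of a \<open>k\<close>-split. The relation \<open>V ij \<in> aff H\<close> is difunctional, and
  it is total because \<open>H\<close> is inner; hence it has the form \<open>\<alpha> i = \<beta> j\<close>, and by the codimension of \<open>H\<close>
  there are \<open>k\<close> labels. Every maximal cell induces a partial order on the labels. Covering a few test
  points shows that every label \<open>r\<close> is the least element of a maximal cell, so there is just one such
  cell, and that for distinct \<open>r, a, b\<close> either \<open>a < b\<close> in the cell of \<open>r\<close> or \<open>r < b\<close> in the cell of \<open>a\<close>.
  As cells meet in faces, both cannot hold. These are the axioms of a cyclic order, whose rotations
  are the orders of the cells.

  The number of cells that contain \<open>V ij\<close> determines \<open>\<beta> j - \<alpha> i\<close> modulo \<open>k\<close>, so a split determines its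
  labelling up to rotation.
\<close>

section \<open>Faces of convex sets\<close>

lemma face_of_linear_zero_set:
  fixes f :: "'a::real_vector \<Rightarrow> real"
  assumes f: "linear f" and C: "convex C" and nonneg: "\<And>x. x \<in> C \<Longrightarrow> 0 \<le> f x"
  shows "{x \<in> C. f x = 0} face_of C"
proof -
  have "convex (C \<inter> f -` {0})"
    by (intro convex_Int C convex_linear_vimage f convex_singleton)
  then have "convex {x \<in> C. f x = 0}"
    by (simp add: Int_def vimage_def)
  moreover have "f a = 0 \<and> f b = 0"
    if ab: "a \<in> C" "b \<in> C" and x: "x \<in> open_segment a b" "f x = 0" for a b x
  proof -
    obtain u where u: "0 < u" "u < 1" "x = (1 - u) *\<^sub>R a + u *\<^sub>R b"
      using x(1) by (auto simp: in_segment)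
    then have "(1 - u) * f a + u * f b = 0"
      using x(2) by (simp add: linear_add[OF f] linear_scale[OF f])
    moreover have "0 \<le> (1 - u) * f a" "0 \<le> u * f b"
      using u nonneg[OF ab(1)] nonneg[OF ab(2)] by auto
    ultimately have "(1 - u) * f a = 0" "u * f b = 0"
      by linarith+
    then show ?thesis
      using u by auto
  qed
  ultimately show ?thesis
    unfolding face_of_def by auto
qed

text \<open>\<open>face_of\<close> speaks of open segments, which are empty when the endpoints
  coincide; this form admits \<open>a = b\<close>.\<close>

lemma face_of_contains_endpoint:
  fixes a b :: "'a::real_vector"
  assumes "F face_of C" "a \<in> C" "b \<in> C" "0 < t" "t < 1" "(1 - t) *\<^sub>R a + t *\<^sub>R b \<in> F"
  shows "a \<in> F" "b \<in> F"
proof -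
  have "a \<in> F \<and> b \<in> F"
  proof (cases "a = b")
    case True
    with assms show ?thesis
      by (simp add: algebra_simps flip: scaleR_left_distrib)
  next
    case False
    then have "(1 - t) *\<^sub>R a + t *\<^sub>R b \<in> open_segment a b"
      using assms by (auto simp: in_segment)
    then show ?thesis
      using face_ofD assms by blast
  qed
  then show "a \<in> F" "b \<in> F"
    by auto
qed


section \<open>Vertices and linear forms\<close>

definition product_vertex :: "'d \<Rightarrow> 'l \<Rightarrow> (real ^ 'd) \<times> (real ^ 'l)" where
  "product_vertex i j = (axis i 1, axis j 1)"

definition lin_form :: "('d \<Rightarrow> real) \<Rightarrow> ('l \<Rightarrow> real) \<Rightarrow> (real ^ 'd) \<times> (real ^ 'l) \<Rightarrow> real" where
  "lin_form g h p = (\<Sum>i\<in>UNIV. g i * fst p $ i) + (\<Sum>j\<in>UNIV. h j * snd p $ j)"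

text \<open>Subpolytopes are encoded by bipartite graphs between the two index sets: an edge ij
  stands for the vertex (e_i, e_j) of the product.\<close>

definition edge_hull :: "('d \<Rightarrow> 'l \<Rightarrow> bool) \<Rightarrow> ((real ^ 'd) \<times> (real ^ 'l)) set" where
  "edge_hull E = convex hull {product_vertex i j |i j. E i j}"

lemma linear_lin_form: "linear (lin_form g h)"
  by (rule linearI)
     (simp_all add: lin_form_def algebra_simps sum.distrib sum_distrib_left)

lemma lin_form_product_vertex [simp]: "lin_form g h (product_vertex i j) = g i + h j"
  by (simp add: lin_form_def product_vertex_def axis_def if_distrib if_distribR cong: if_cong)

lemma lin_form_add_coeffs:
  "lin_form (\<lambda>i. g i + g' i) (\<lambda>j. h j + h' j) p = lin_form g h p + lin_form g' h' p"
  by (simp add: lin_form_def algebra_simps sum.distrib)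

lemma lin_form_diff_coeffs:
  "lin_form (\<lambda>i. g i - g' i) (\<lambda>j. h j - h' j) p = lin_form g h p - lin_form g' h' p"
  by (simp add: lin_form_def algebra_simps sum_subtractf)

lemma product_vertex_eq_iff [simp]:
  "product_vertex i j = product_vertex i' j' \<longleftrightarrow> i = i' \<and> j = j'"
  by (auto simp: product_vertex_def axis_eq_axis)

text \<open>The affine relation behind every exchange of vertices, in affine hulls as well as in
  cells.\<close>

lemma product_vertex_parallelogram:
  "product_vertex i j + product_vertex i' j' = product_vertex i j' + product_vertex i' j"
  by (simp add: product_vertex_def)

lemma finite_edges: "finite {product_vertex i j |i j. E i j}"
proof -
  have "{product_vertex i j |i j. E i j} \<subseteq> (\<lambda>e. product_vertex (fst e) (snd e)) ` UNIV"
    by (auto intro: image_eqI[of _ _ "(i, j)" for i j])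
  then show ?thesis
    by (rule finite_subset) simp
qed

lemma polytope_edge_hull: "polytope (edge_hull E)"
  unfolding edge_hull_def by (rule polytope_convex_hull[OF finite_edges])

lemma convex_edge_hull: "convex (edge_hull E)"
  by (simp add: edge_hull_def)

lemma edge_hull_subset:
  assumes "convex C" "\<And>i j. E i j \<Longrightarrow> product_vertex i j \<in> C"
  shows "edge_hull E \<subseteq> C"
  unfolding edge_hull_def by (rule hull_minimal) (use assms in auto)

lemma product_vertex_in_edge_hull: "E i j \<Longrightarrow> product_vertex i j \<in> edge_hull E"
  unfolding edge_hull_def by (rule hull_inc) auto

text \<open>Used mostly by contraposition: a form that is negative at a point of the hull and
  nonnegative on all edges but one forces this edge to be present.\<close>

lemma lin_form_nonneg_on_edge_hull:
  assumes "p \<in> edge_hull E" "\<And>i j. E i j \<Longrightarrow> 0 \<le> g i + h j"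
  shows "0 \<le> lin_form g h p"
proof -
  have "convex (lin_form g h -` {0..})"
    by (intro convex_linear_vimage linear_lin_form) (simp add: convex_real_interval)
  then have "edge_hull E \<subseteq> lin_form g h -` {0..}"
    by (rule edge_hull_subset) (simp add: assms(2))
  then show ?thesis
    using assms(1) by auto
qed

lemma unit_simplex_iff:
  "x \<in> unit_simplex \<longleftrightarrow> (\<forall>i. 0 \<le> x $ i) \<and> (\<Sum>i\<in>UNIV. x $ i) = 1"
proof -
  have "x $ i \<le> 1" if "\<forall>i. 0 \<le> x $ i" "(\<Sum>i\<in>UNIV. x $ i) = 1" for i
  proof -
    have "(\<Sum>i\<in>{i}. x $ i) \<le> (\<Sum>i\<in>UNIV. x $ i)"
      by (rule sum_mono2) (use that in auto)
    with that show ?thesis by simp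
  qed
  then show ?thesis
    by (auto simp: unit_simplex_def)
qed

lemma simplex_product_iff:
  "p \<in> simplex_product \<longleftrightarrow> (\<forall>i. 0 \<le> fst p $ i) \<and> (\<forall>j. 0 \<le> snd p $ j) \<and>
     (\<Sum>i\<in>UNIV. fst p $ i) = 1 \<and> (\<Sum>j\<in>UNIV. snd p $ j) = 1"
  by (auto simp: simplex_product_def mem_Times_iff unit_simplex_iff)

lemma product_vertex_in_simplex_product [simp]: "product_vertex i j \<in> simplex_product"
  by (simp add: simplex_product_iff product_vertex_def axis_def)

lemma convex_unit_simplex: "convex unit_simplex"
proof (rule convexI)
  fix x y :: "real ^ 'e" and u v :: real
  assume xy: "x \<in> unit_simplex" "y \<in> unit_simplex" and uv: "0 \<le> u" "0 \<le> v" "u + v = 1"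
  have "u * x $ i + v * y $ i \<le> u * 1 + v * 1" for i
    using xy uv by (intro add_mono mult_left_mono) (auto simp: unit_simplex_def)
  then show "u *\<^sub>R x + v *\<^sub>R y \<in> unit_simplex"
    using xy uv by (auto simp: unit_simplex_def sum.distrib simp flip: sum_distrib_left)
qed

lemma compact_unit_simplex: "compact (unit_simplex :: (real ^ 'e) set)"
proof -
  have "unit_simplex = cbox 0 1 \<inter> {x :: real ^ 'e. (\<Sum>i\<in>UNIV. x $ i) = 1}"
    by (auto simp: unit_simplex_def mem_box_cart)
  moreover have "closed {x :: real ^ 'e. (\<Sum>i\<in>UNIV. x $ i) = 1}"
    by (intro closed_Collect_eq continuous_intros)
  ultimately show ?thesis
    by (metis compact_Int_closed compact_cbox)
qed

lemma convex_simplex_product: "convex simplex_product"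
  unfolding simplex_product_def by (intro convex_Times convex_unit_simplex)

lemma compact_simplex_product: "compact simplex_product"
  unfolding simplex_product_def by (intro compact_Times compact_unit_simplex)

lemma edge_hull_subset_simplex_product: "edge_hull E \<subseteq> simplex_product"
  by (rule edge_hull_subset) (simp_all add: convex_simplex_product)


section \<open>Dominance cells\<close>

text \<open>The difference of the cumulative distributions of x and y after both are pushed forward
  to the labels. Nonnegativity for all \<open>q\<close> is first-order stochastic dominance.\<close>

definition dominance_form :: "('d \<Rightarrow> nat) \<Rightarrow> ('l \<Rightarrow> nat) \<Rightarrow> nat \<Rightarrow> (real ^ 'd) \<times> (real ^ 'l) \<Rightarrow> real" where
  "dominance_form a b q = lin_form (\<lambda>i. of_bool (a i < q)) (\<lambda>j. - of_bool (b j < q))"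

lemma linear_dominance_form: "linear (dominance_form a b q)"
  by (simp add: dominance_form_def linear_lin_form)

lemma dominance_form_product_vertex:
  "dominance_form a b q (product_vertex i j) = of_bool (a i < q) - of_bool (b j < q)"
  by (simp add: dominance_form_def)

lemma dominance_form_alt:
  "dominance_form a b q p = (\<Sum>i | a i < q. fst p $ i) - (\<Sum>j | b j < q. snd p $ j)"
  by (simp add: dominance_form_def lin_form_def sum_negf sum.If_cases of_bool_def if_distrib
        if_distribR Collect_conj_eq cong: if_cong)

text \<open>Monotone coupling: match the first row and the first column that carry mass. Removing
  the resulting vertex with the largest possible weight preserves dominance, so an extreme point
  must be that vertex.\<close>

lemma extreme_point_dominance:
  fixes a :: "'d::finite \<Rightarrow> nat" and b :: "'l::finite \<Rightarrow> nat"
  defines "D \<equiv> {p \<in> simplex_product. \<forall>q. 0 \<le> dominance_form a b q p}"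
  assumes "p extreme_point_of D"
  shows "\<exists>i j. a i \<le> b j \<and> p = product_vertex i j"
proof -
  have pD: "p \<in> D"
    using assms(2) by (simp add: extreme_point_of_def)
  then have p: "\<And>i. 0 \<le> fst p $ i" "\<And>j. 0 \<le> snd p $ j"
     "(\<Sum>i\<in>UNIV. fst p $ i) = 1" "(\<Sum>j\<in>UNIV. snd p $ j) = 1"
    and dom: "\<And>q. 0 \<le> dominance_form a b q p"
    by (auto simp: D_def simplex_product_iff)
  have "\<exists>i. 0 < fst p $ i"
  proof (rule ccontr)
    assume "\<nexists>i. 0 < fst p $ i"
    then have "\<And>i. fst p $ i = 0" using p(1) by (metis less_eq_real_def)
    then show False using p(3) by simp
  qed
  then obtain i where i: "0 < fst p $ i" "\<And>i'. 0 < fst p $ i' \<Longrightarrow> a i \<le> a i'"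
    using ex_has_least_nat[of "\<lambda>i. 0 < fst p $ i"] by metis
  have "\<exists>j. 0 < snd p $ j"
  proof (rule ccontr)
    assume "\<nexists>j. 0 < snd p $ j"
    then have "\<And>j. snd p $ j = 0" using p(2) by (metis less_eq_real_def)
    then show False using p(4) by simp
  qed
  then obtain j where j: "0 < snd p $ j" "\<And>j'. 0 < snd p $ j' \<Longrightarrow> b j \<le> b j'"
    using ex_has_least_nat[of "\<lambda>j. 0 < snd p $ j"] by metis
  have x0: "fst p $ i' = 0" if "a i' < a i" for i'
    using i(2)[of i'] that p(1)[of i'] by (metis less_eq_real_def not_less)
  have y0: "snd p $ j' = 0" if "b j' < b j" for j'
    using j(2)[of j'] that p(2)[of j'] by (metis less_eq_real_def not_less)
  \<comment> \<open>Otherwise y has mass below \<open>a i\<close>, where x has none, and dominance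
    fails at \<open>q = a i\<close>.\<close>
  have le: "a i \<le> b j"
  proof (rule ccontr)
    assume "\<not> a i \<le> b j"
    then have "(\<Sum>j'\<in>{j}. snd p $ j') \<le> (\<Sum>j' | b j' < a i. snd p $ j')"
      by (intro sum_mono2) (use p in auto)
    moreover have "(\<Sum>i' | a i' < a i. fst p $ i') = 0"
      by (rule sum.neutral) (use x0 in auto)
    ultimately show False
      using dom[of "a i"] j(1) by (simp add: dominance_form_alt)
  qed
  define v where "v = product_vertex i j"
  \<comment> \<open>The largest weight for which \<open>p - t *\<^sub>R v\<close> has nonnegative
    coordinates.\<close>
  define t where "t = min (fst p $ i) (snd p $ j)"
  have t: "0 < t" "t \<le> fst p $ i" "t \<le> snd p $ j"
    using i(1) j(1) by (auto simp: t_def)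
  \<comment> \<open>The form of \<open>v\<close> is 1 exactly for \<open>a i < q \<le> b j\<close>
    and 0 otherwise. In that range x has mass at least \<open>t\<close> below \<open>q\<close> and y
    has none.\<close>
  have dom_t: "t * dominance_form a b q v \<le> dominance_form a b q p" for q
  proof (cases "a i < q \<and> q \<le> b j")
    case True
    have "(\<Sum>i'\<in>{i}. fst p $ i') \<le> (\<Sum>i' | a i' < q. fst p $ i')"
      by (intro sum_mono2) (use p True in auto)
    moreover have "(\<Sum>j' | b j' < q. snd p $ j') = 0"
      by (rule sum.neutral) (use y0 True in auto)
    ultimately show ?thesis
      using t True by (simp add: dominance_form_alt[of _ _ _ p] v_def dominance_form_product_vertex)
  next
    case False
    then have "dominance_form a b q v = 0"
      using le by (auto simp: v_def dominance_form_product_vertex)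
    then show ?thesis using dom by simp
  qed
  define r where "r = p - t *\<^sub>R v"
  have r_nonneg: "0 \<le> fst r $ i'" "0 \<le> snd r $ j'" for i' j'
    using t p(1)[of i'] p(2)[of j'] by (auto simp: r_def v_def product_vertex_def axis_def)
  have r_sum: "(\<Sum>i'\<in>UNIV. fst r $ i') = 1 - t" "(\<Sum>j'\<in>UNIV. snd r $ j') = 1 - t"
    using p(3,4)
    by (simp_all add: r_def v_def product_vertex_def sum_subtractf axis_def if_distrib[of "(*) t"] cong: if_cong)
  have t1: "t \<le> 1"
    using sum_nonneg[of UNIV "\<lambda>i'. fst r $ i'"] r_nonneg(1) r_sum(1) by simp
  have "p = v"
  proof (cases "t = 1")
    case True
    have "fst r $ i' = 0" for i'
      using sum_nonneg_0[of UNIV "\<lambda>a. fst r $ a" i'] r_nonneg(1) r_sum(1) True by simp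
    moreover have "snd r $ j' = 0" for j'
      using sum_nonneg_0[of UNIV "\<lambda>a. snd r $ a" j'] r_nonneg(2) r_sum(2) True by simp
    ultimately have "r = 0"
      by (simp add: prod_eq_iff vec_eq_iff)
    then show ?thesis using True by (simp add: r_def)
  next
    case False
    \<comment> \<open>The remainder rescaled to mass 1; it is again a point of \<open>D\<close>, and
      \<open>p\<close> is a proper convex combination of \<open>w\<close> and
      \<open>v\<close>.\<close>
    define w where "w = (1 / (1 - t)) *\<^sub>R r"
    have t': "0 < 1 - t" using False t1 by simp
    have "w \<in> simplex_product"
      unfolding simplex_product_iff
      using r_nonneg r_sum t'
      by (simp add: w_def flip: sum_divide_distrib)
    moreover have "0 \<le> dominance_form a b q w" for q
      using dom_t[of q] t'
      by (simp add: w_def r_def linear_diff[OF linear_dominance_form] linear_scale[OF linear_dominance_form])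
    ultimately have wD: "w \<in> D"
      by (simp add: D_def)
    have vD: "v \<in> D"
      using le by (auto simp: D_def v_def dominance_form_product_vertex)
    have pw: "p = (1 - t) *\<^sub>R w + t *\<^sub>R v"
      using t' by (simp add: w_def r_def)
    show ?thesis
    proof (cases "w = v")
      case True
      then show ?thesis using pw by (simp flip: scaleR_left_distrib)
    next
      case False
      then have "p \<in> open_segment w v"
        using pw t t' by (auto simp: in_segment)
      then show ?thesis
        using assms(2) wD vD by (auto simp: extreme_point_of_def)
    qed
  qed
  then show ?thesis
    using le v_def by blast
qed

text \<open>A compact convex set is the hull of its extreme points. This passes from a description
  by inequalities to one by vertices.\<close>

lemma dominance_cell:
  "{p \<in> simplex_product. \<forall>q. 0 \<le> dominance_form a b q p} = edge_hull (\<lambda>i j. a i \<le> b j)"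
  (is "?D = _")
proof
  have eq: "?D = simplex_product \<inter> (\<Inter>q. dominance_form a b q -` {0..})"
    by auto
  have "convex ?D"
    unfolding eq
    by (intro convex_Int convex_INT convex_simplex_product convex_linear_vimage linear_dominance_form)
       (simp add: convex_real_interval)
  moreover have "closed (dominance_form a b q -` {0..})" for q
    using linear_dominance_form
    by (intro closed_vimage linear_continuous_on) (auto simp: linear_conv_bounded_linear)
  then have "compact ?D"
    unfolding eq by (intro compact_Int_closed compact_simplex_product closed_INT) auto
  ultimately have "?D = convex hull {p. p extreme_point_of ?D}"
    by (rule Krein_Milman_Minkowski[rotated])
  also have "\<dots> \<subseteq> edge_hull (\<lambda>i j. a i \<le> b j)"
    unfolding edge_hull_def
  proof (rule hull_mono, rule subsetI)
    fix p assume "p \<in> {p. p extreme_point_of ?D}"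
    then have "\<exists>i j. a i \<le> b j \<and> p = product_vertex i j"
      using extreme_point_dominance by blast
    then show "p \<in> {product_vertex i j |i j. a i \<le> b j}" by blast
  qed
  finally show "?D \<subseteq> edge_hull (\<lambda>i j. a i \<le> b j)" .
  show "edge_hull (\<lambda>i j. a i \<le> b j) \<subseteq> ?D"
    using \<open>convex ?D\<close>
    by (rule edge_hull_subset) (auto simp: dominance_form_product_vertex)
qed

text \<open>The case of constant labels, where all dominance forms vanish on the product.\<close>

lemma simplex_product_eq_edge_hull: "simplex_product = edge_hull (\<lambda>i j. True)"
proof -
  have "0 \<le> dominance_form (\<lambda>i. 0) (\<lambda>j. 0) q p"
    if "p \<in> simplex_product" for q and p :: "(real ^ 'd) \<times> (real ^ 'l)"
    using that by (cases "q = 0") (simp_all add: dominance_form_alt simplex_product_iff)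
  then show ?thesis
    using dominance_cell[of "\<lambda>i. 0" "\<lambda>j. 0"] by auto
qed

lemma verts_simplex_product: "verts simplex_product = {product_vertex i j |i j. True}"
proof (intro equalityI subsetI)
  fix p :: "(real ^ 'd) \<times> (real ^ 'l)"
  assume "p \<in> verts simplex_product"
  then show "p \<in> {product_vertex i j |i j. True}"
    unfolding verts_def simplex_product_eq_edge_hull edge_hull_def
    by (auto dest: extreme_point_of_convex_hull)
next
  fix p :: "(real ^ 'd) \<times> (real ^ 'l)"
  assume "p \<in> {product_vertex i j |i j. True}"
  then obtain i j where p: "p = product_vertex i j" by blast
  \<comment> \<open>The mass of x off \<open>i\<close> plus the mass of y off \<open>j\<close>:
    nonnegative on the product and zero only at the vertex.\<close>
  define f where "f = lin_form (\<lambda>i'. of_bool (i' \<noteq> i)) (\<lambda>j'. of_bool (j' \<noteq> j) :: real)"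
  have face: "{q \<in> simplex_product. f q = 0} face_of simplex_product"
    unfolding f_def simplex_product_eq_edge_hull
    by (intro face_of_linear_zero_set linear_lin_form convex_edge_hull lin_form_nonneg_on_edge_hull) auto
  have "q = product_vertex i j" if q: "q \<in> simplex_product" "f q = 0" for q
  proof -
    have nn: "0 \<le> (\<Sum>i'\<in>UNIV. of_bool (i' \<noteq> i) * fst q $ i')" "0 \<le> (\<Sum>j'\<in>UNIV. of_bool (j' \<noteq> j) * snd q $ j')"
      using q by (auto simp: simplex_product_iff intro!: sum_nonneg)
    then have "(\<Sum>i'\<in>UNIV. of_bool (i' \<noteq> i) * fst q $ i') = 0" "(\<Sum>j'\<in>UNIV. of_bool (j' \<noteq> j) * snd q $ j') = 0"
      using q(2) by (auto simp: f_def lin_form_def)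
    then have 0: "\<And>i'. of_bool (i' \<noteq> i) * fst q $ i' = 0" "\<And>j'. of_bool (j' \<noteq> j) * snd q $ j' = 0"
      using q by (auto simp: simplex_product_iff sum_nonneg_eq_0_iff)
    then have 1: "fst q $ i' = 0" if "i' \<noteq> i" for i' using that by auto
    from 0 have 2: "snd q $ j' = 0" if "j' \<noteq> j" for j' using that by auto
    have "(\<Sum>i'\<in>UNIV. fst q $ i') = (\<Sum>i'\<in>{i}. fst q $ i')"
      by (rule sum.mono_neutral_right) (use 1 in auto)
    moreover have "(\<Sum>j'\<in>UNIV. snd q $ j') = (\<Sum>j'\<in>{j}. snd q $ j')"
      by (rule sum.mono_neutral_right) (use 2 in auto)
    ultimately have "fst q $ i = 1" "snd q $ j = 1"
      using q(1) by (auto simp: simplex_product_iff)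
    with 1 2 show ?thesis
      by (auto simp: prod_eq_iff vec_eq_iff product_vertex_def axis_def)
  qed
  then have "{q \<in> simplex_product. f q = 0} = {p}"
    using p by (auto simp: f_def)
  then show "p \<in> verts simplex_product"
    using face by (simp add: verts_def face_of_singleton)
qed

text \<open>By this the cells of a subdivision are known once the vertices in them are known, so
  that the rest can argue with graphs.\<close>

lemma polytope_eq_edge_hull:
  assumes "polytope C" "verts C \<subseteq> verts simplex_product"
  shows "C = edge_hull (\<lambda>i j. product_vertex i j \<in> C)"
proof
  have "C = convex hull verts C"
    unfolding verts_def
    using Krein_Milman_Minkowski[OF polytope_imp_compact polytope_imp_convex] assms(1) by blast
  moreover have "verts C \<subseteq> {product_vertex i j |i j. product_vertex i j \<in> C}"
    using assms(2) unfolding verts_simplex_product by (auto simp: verts_def extreme_point_of_def)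
  ultimately show "C \<subseteq> edge_hull (\<lambda>i j. product_vertex i j \<in> C)"
    unfolding edge_hull_def by (metis (no_types, lifting) hull_mono)
  show "edge_hull (\<lambda>i j. product_vertex i j \<in> C) \<subseteq> C"
    by (rule edge_hull_subset) (use assms polytope_imp_convex in auto)
qed

lemma verts_face_of_edge_hull: "F face_of edge_hull E \<Longrightarrow> verts F \<subseteq> verts simplex_product"
  unfolding verts_simplex_product
  by (auto simp: verts_def extreme_point_of_face edge_hull_def dest!: extreme_point_of_convex_hull)

text \<open>A form that is nonnegative on the polytope and zero at an inner point cuts out a face
  meeting the relative interior, hence vanishes everywhere; coordinates do not.\<close>

lemma rel_interior_simplex_product_pos:
  assumes "p \<in> rel_interior simplex_product"
  shows "0 < fst p $ i" "0 < snd p $ j"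
proof -
  have pP: "p \<in> simplex_product"
    using assms rel_interior_subset by blast
  have key: "lin_form g h p \<noteq> 0"
    if nn: "\<And>i j. 0 \<le> g i + h j" and pos: "0 < g i + h j" for g h and i j
  proof
    assume 0: "lin_form g h p = 0"
    have "{q \<in> simplex_product. lin_form g h q = 0} face_of simplex_product"
      unfolding simplex_product_eq_edge_hull using nn
      by (intro face_of_linear_zero_set linear_lin_form convex_edge_hull lin_form_nonneg_on_edge_hull) auto
    then have "simplex_product \<subseteq> {q \<in> simplex_product. lin_form g h q = 0}"
      by (rule subset_of_face_of) (use 0 assms pP in auto)
    moreover have "product_vertex i j \<in> simplex_product" by simp
    ultimately have "lin_form g h (product_vertex i j) = 0" by blast
    with pos show False by simp
  qed
  have "fst p $ i \<noteq> 0"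
    using key[of "\<lambda>i'. of_bool (i' = i)" "\<lambda>j. 0" i] by (simp add: lin_form_def of_bool_def if_distrib if_distribR cong: if_cong)
  moreover have "snd p $ j \<noteq> 0"
    using key[of "\<lambda>i. 0" "\<lambda>j'. of_bool (j' = j)" _ j] by (simp add: lin_form_def of_bool_def if_distrib if_distribR cong: if_cong)
  ultimately show "0 < fst p $ i" "0 < snd p $ j"
    using pP by (auto simp: simplex_product_iff less_le)
qed

text \<open>Every segment ending in \<open>p\<close> can be prolonged beyond \<open>p\<close> by the
  factor \<open>m\<close>, the least coordinate: this subtracts at most \<open>m\<close> from
  coordinates of \<open>(1 + m) *\<^sub>R p\<close>, which are at least \<open>m\<close>.\<close>

lemma rel_interior_simplex_productI:
  assumes pP: "p \<in> simplex_product" and pos: "\<And>i. 0 < fst p $ i" "\<And>j. 0 < snd p $ j"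
  shows "p \<in> rel_interior simplex_product"
proof -
  define m where "m = Min (range (\<lambda>i. fst p $ i) \<union> range (\<lambda>j. snd p $ j))"
  have m: "0 < m" "m \<le> fst p $ i" "m \<le> snd p $ j" for i j
    using pos by (auto simp: m_def Min_gr_iff intro!: Min_le)
  have "\<exists>e>1. (1 - e) *\<^sub>R x + e *\<^sub>R p \<in> simplex_product" if x: "x \<in> simplex_product" for x
  proof (intro exI conjI)
    show "1 + m > 1" using m by simp
    have x1: "fst x $ i \<le> 1" "snd x $ j \<le> 1" for i j
      using x by (auto simp: simplex_product_def unit_simplex_def)
    have "m * fst x $ i \<le> m * 1" "m * snd x $ j \<le> m * 1" for i j
      using m(1) by (intro mult_left_mono x1; simp)+
    moreover have "m \<le> (1 + m) * fst p $ i" "m \<le> (1 + m) * snd p $ j" for i j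
      using m(2)[of i] m(3)[of j] mult_pos_pos[OF m(1) pos(1)[of i]] mult_pos_pos[OF m(1) pos(2)[of j]]
      by (simp_all add: distrib_right)
    ultimately have "m * fst x $ i \<le> (1 + m) * fst p $ i \<and> m * snd x $ j \<le> (1 + m) * snd p $ j" for i j
      by (metis mult.right_neutral order_trans)
    then show "(1 - (1 + m)) *\<^sub>R x + (1 + m) *\<^sub>R p \<in> simplex_product"
      using x pP unfolding simplex_product_iff
      by (auto simp: sum.distrib sum_subtractf simp flip: sum_distrib_left)
  qed
  moreover have "(simplex_product :: ((real ^ 'a) \<times> (real ^ 'b)) set) \<noteq> {}"
    using product_vertex_in_simplex_product by blast
  ultimately show ?thesis
    using convex_rel_interior_iff[OF convex_simplex_product] by blast
qed

text \<open>For labels below \<open>k\<close> this form is the height \<open>u_k\<close> of the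
  overview. It vanishes like \<open>u_0\<close>, which lets the heights wrap around the
  circle.\<close>

lemma lin_form_one_minus_one:
  "p \<in> simplex_product \<Longrightarrow> lin_form (\<lambda>_. 1) (\<lambda>_. - 1) p = 0"
  by (simp add: lin_form_def simplex_product_iff sum_negf)


section \<open>Cyclic labellings and their splits\<close>

text \<open>Compares positions on a circle of \<open>k\<close> labels, counted from
  \<open>r\<close>. Adding \<open>k\<close> first keeps the subtraction from truncating for
  \<open>r \<le> k\<close>.\<close>

definition cyc_le :: "nat \<Rightarrow> nat \<Rightarrow> nat \<Rightarrow> nat \<Rightarrow> bool" where
  "cyc_le k r a b \<longleftrightarrow> (a + k - r) mod k \<le> (b + k - r) mod k"

lemma cyc_position:
  fixes a k r :: nat
  assumes "a < k" "r < k"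
  shows "(a + k - r) mod k = (if r \<le> a then a - r else a + k - r)"
proof (cases "r \<le> a")
  case True
  then have "(a + k - r) mod k = (a - r + k) mod k" by simp
  also have "\<dots> = a - r" using assms(1) by (subst mod_add_self2) simp
  finally show ?thesis using True by simp
qed (use assms in simp)

lemma cyc_le_iff:
  assumes "a < k" "b < k" "r < k"
  shows "cyc_le k r a b \<longleftrightarrow> (if a \<le> b then r \<le> a \<or> b < r else b < r \<and> r \<le> a)"
  using assms by (auto simp: cyc_le_def cyc_position)

text \<open>The circle is cut only in front of \<open>r\<close>; hence two different starting points
  together admit every step to the next label.\<close>

lemma cyc_le_Suc:
  assumes "a < k" "r < k" "r \<noteq> Suc a mod k"
  shows "cyc_le k r a (Suc a mod k)"
proof (cases "Suc a = k")
  case True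
  then show ?thesis using assms by (auto simp: cyc_le_iff)
next
  case False
  then have "Suc a < k" using assms(1) by simp
  then show ?thesis using assms by (auto simp: cyc_le_iff)
qed

text \<open>A step back by one label is possible only across the cut. This serves to tell the cells
  apart.\<close>

lemma cyc_le_Suc_left:
  assumes "a < k" "r < k" "2 \<le> k"
  shows "cyc_le k r (Suc a mod k) a \<longleftrightarrow> r = Suc a mod k"
proof (cases "Suc a = k")
  case True
  then show ?thesis using assms by (auto simp: cyc_le_iff)
next
  case False
  then have "Suc a < k" using assms(1) by simp
  then show ?thesis using assms by (auto simp: cyc_le_iff)
qed

definition split_cell :: "nat \<Rightarrow> ('d \<Rightarrow> nat) \<Rightarrow> ('l \<Rightarrow> nat) \<Rightarrow> nat \<Rightarrow> ((real ^ 'd) \<times> (real ^ 'l)) set" where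
  "split_cell k \<alpha> \<beta> r = edge_hull (\<lambda>i j. cyc_le k r (\<alpha> i) (\<beta> j))"

definition split_of :: "nat \<Rightarrow> ('d \<Rightarrow> nat) \<Rightarrow> ('l \<Rightarrow> nat) \<Rightarrow> ((real ^ 'd) \<times> (real ^ 'l)) set set" where
  "split_of k \<alpha> \<beta> = {F. \<exists>r<k. F face_of split_cell k \<alpha> \<beta> r}"

text \<open>The fibres over \<open>r\<close> form the pair of parts (A_r, B_r); that the ranges are
  all of \<open>{..<k}\<close> says that no part is empty.\<close>

locale labelling =
  fixes k :: nat and \<alpha> :: "'d::finite \<Rightarrow> nat" and \<beta> :: "'l::finite \<Rightarrow> nat"
  assumes range_\<alpha>: "range \<alpha> = {..<k}" and range_\<beta>: "range \<beta> = {..<k}"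
begin

lemma \<alpha>_less [simp]: "\<alpha> i < k"
  using range_\<alpha> by blast

lemma \<beta>_less [simp]: "\<beta> j < k"
  using range_\<beta> by blast

lemma k_pos: "0 < k"
  using \<alpha>_less by (metis gr0I less_nat_zero_code)

lemma ex_\<alpha>: "r < k \<Longrightarrow> \<exists>i. \<alpha> i = r"
  using range_\<alpha> by (metis imageE lessThan_iff)

lemma ex_\<beta>: "r < k \<Longrightarrow> \<exists>j. \<beta> j = r"
  using range_\<beta> by (metis imageE lessThan_iff)

abbreviation "height \<equiv> dominance_form \<alpha> \<beta>"

lemma height_0 [simp]: "height 0 p = 0"
  by (simp add: dominance_form_alt)

text \<open>The labels at positions below \<open>q\<close> form an arc of the circle. Its indicator
  is a difference of two indicators of initial segments, plus the constant 1 if the arc wraps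
  around; the constant contributes nothing since x and y have equal mass.\<close>

lemma dominance_form_rotated:
  fixes r q :: nat
  defines "a \<equiv> (\<lambda>i. (\<alpha> i + k - r) mod k)" and "b \<equiv> (\<lambda>j. (\<beta> j + k - r) mod k)"
  assumes p: "p \<in> simplex_product" and "r < k"
  shows "dominance_form a b q p =
    (if k \<le> q then 0 else if r + q < k then height (r + q) p - height r p
     else height (r + q - k) p - height r p)"
proof -
  have *: "(\<gamma> + k - r) mod k = (if r \<le> \<gamma> then \<gamma> - r else \<gamma> + k - r)" if "\<gamma> < k" for \<gamma>
    using cyc_position[OF that \<open>r < k\<close>] .
  consider "k \<le> q" | "q < k" "r + q < k" | "q < k" "k \<le> r + q" by linarith
  then show ?thesis
  proof cases
    case 1
    have "a i < q" "b j < q" for i j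
      using 1 k_pos by (auto simp: a_def b_def intro: less_le_trans[OF mod_less_divisor])
    then have "dominance_form a b q p = 0"
      using p by (simp add: dominance_form_alt simplex_product_iff)
    then show ?thesis using 1 by simp
  next
    case 2
    have **: "((of_bool ((if r \<le> \<gamma> then \<gamma> - r else \<gamma> + k - r) < q)) :: real)
      = of_bool (\<gamma> < r + q) - of_bool (\<gamma> < r)" if "\<gamma> < k" for \<gamma>
      using that 2 \<open>r < k\<close> by auto
    have "of_bool (a i < q) = (of_bool (\<alpha> i < r + q) - of_bool (\<alpha> i < r) :: real)" for i
      unfolding a_def using ** * by simp
    moreover have "- of_bool (b j < q) = (- of_bool (\<beta> j < r + q) - - of_bool (\<beta> j < r) :: real)" for j
      unfolding b_def using ** * by simp
    ultimately have "dominance_form a b q p = height (r + q) p - height r p"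
      unfolding dominance_form_def lin_form_diff_coeffs[symmetric] by presburger
    then show ?thesis using 2 by simp
  next
    case 3
    have **: "((of_bool ((if r \<le> \<gamma> then \<gamma> - r else \<gamma> + k - r) < q)) :: real)
      = 1 + (of_bool (\<gamma> < r + q - k) - of_bool (\<gamma> < r))" if "\<gamma> < k" for \<gamma>
      using that 3 \<open>r < k\<close> by auto
    have "of_bool (a i < q) = (1 + (of_bool (\<alpha> i < r + q - k) - of_bool (\<alpha> i < r)) :: real)" for i
      unfolding a_def using ** * by simp
    moreover have "- of_bool (b j < q) = (- 1 + (- of_bool (\<beta> j < r + q - k) - - of_bool (\<beta> j < r)) :: real)" for j
      unfolding b_def using ** * by simp
    ultimately have "dominance_form a b q p
        = lin_form (\<lambda>_. 1) (\<lambda>_. - 1) p + (height (r + q - k) p - height r p)"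
      unfolding dominance_form_def lin_form_diff_coeffs[symmetric] lin_form_add_coeffs[symmetric]
      by presburger
    then show ?thesis using 3 p by (simp add: lin_form_one_minus_one)
  qed
qed

text \<open>By the rotation formula, dominance for the positions counted from \<open>r\<close> is
  minimality of \<open>height r\<close>. The threshold that yields the inequality for
  \<open>q\<close> is the position of \<open>q\<close>.\<close>

lemma split_cell_eq:
  assumes r: "r < k"
  shows "split_cell k \<alpha> \<beta> r = {p \<in> simplex_product. \<forall>q<k. height r p \<le> height q p}"
proof -
  define a where "a = (\<lambda>i. (\<alpha> i + k - r) mod k)"
  define b where "b = (\<lambda>j. (\<beta> j + k - r) mod k)"
  have "(\<forall>q. 0 \<le> dominance_form a b q p) \<longleftrightarrow> (\<forall>q<k. height r p \<le> height q p)"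
    if p: "p \<in> simplex_product" for p
  proof (intro iffI allI impI)
    fix q assume *: "\<forall>q. 0 \<le> dominance_form a b q p" and q: "q < k"
    show "height r p \<le> height q p"
    proof (cases "r \<le> q")
      case True
      with q have "dominance_form a b (q - r) p = height q p - height r p"
        using dominance_form_rotated[OF p r, of "q - r"] less_imp_diff_less[OF q, of r]
        by (simp add: a_def b_def)
      then show ?thesis using * by (metis diff_ge_0_iff_ge)
    next
      case False
      with q r have "dominance_form a b (q + k - r) p = height q p - height r p"
        using dominance_form_rotated[OF p r, of "q + k - r"] by (auto simp: a_def b_def)
      then show ?thesis using * by (metis diff_ge_0_iff_ge)
    qed
  next
    fix q assume *: "\<forall>q<k. height r p \<le> height q p"
    show "0 \<le> dominance_form a b q p"
      using dominance_form_rotated[OF p r, of q] * r by (auto simp: a_def b_def)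
  qed
  then have "{p \<in> simplex_product. \<forall>q<k. height r p \<le> height q p} = edge_hull (\<lambda>i j. a i \<le> b j)"
    unfolding dominance_cell[symmetric] by blast
  then show ?thesis
    by (simp add: split_cell_def cyc_le_def a_def b_def)
qed

lemma product_vertex_in_split_cell:
  assumes "r < k"
  shows "product_vertex i j \<in> split_cell k \<alpha> \<beta> r \<longleftrightarrow> cyc_le k r (\<alpha> i) (\<beta> j)"
proof
  assume "product_vertex i j \<in> split_cell k \<alpha> \<beta> r"
  then have *: "height r (product_vertex i j) \<le> height q (product_vertex i j)" if "q < k" for q
    using that assms by (simp add: split_cell_eq)
  \<comment> \<open>At a vertex the height, as a function of \<open>q\<close>, is 0 except between
    the two labels, so these three values of \<open>q\<close> detect its minimum.\<close>
  show "cyc_le k r (\<alpha> i) (\<beta> j)"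
    using *[of 0] *[of "\<alpha> i"] *[of "\<beta> j"] assms k_pos
    by (auto simp: dominance_form_product_vertex cyc_le_iff of_bool_def split: if_splits)
qed (simp add: split_cell_def product_vertex_in_edge_hull)

lemma split_cell_subset: "split_cell k \<alpha> \<beta> r \<subseteq> simplex_product"
  by (simp add: split_cell_def edge_hull_subset_simplex_product)

lemma convex_split_cell: "convex (split_cell k \<alpha> \<beta> r)"
  by (simp add: split_cell_def convex_edge_hull)

text \<open>The difference of the two heights is nonnegative on the first cell and vanishes exactly
  where the second cell meets it.\<close>

lemma split_cell_Int_face:
  assumes "r < k" "s < k"
  shows "split_cell k \<alpha> \<beta> r \<inter> split_cell k \<alpha> \<beta> s face_of split_cell k \<alpha> \<beta> r"
proof -
  have "{p \<in> split_cell k \<alpha> \<beta> r. (\<lambda>p. height s p - height r p) p = 0} face_of split_cell k \<alpha> \<beta> r"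
    by (intro face_of_linear_zero_set linear_compose_sub linear_dominance_form convex_split_cell)
       (use assms in \<open>auto simp: split_cell_eq\<close>)
  moreover have "{p \<in> split_cell k \<alpha> \<beta> r. height s p - height r p = 0}
      = split_cell k \<alpha> \<beta> r \<inter> split_cell k \<alpha> \<beta> s"
    using assms by (fastforce simp: split_cell_eq)
  ultimately show ?thesis by simp
qed

lemma split_cells_cover:
  assumes "p \<in> simplex_product"
  shows "\<exists>r<k. p \<in> split_cell k \<alpha> \<beta> r"
proof -
  have "finite {..<k}" "{..<k} \<noteq> {}" using k_pos by auto
  then obtain r where "r \<in> {..<k}" "\<forall>q\<in>{..<k}. height r p \<le> height q p"
    using arg_min_if_finite[of "{..<k}" "\<lambda>q. height q p"] by (metis not_less)
  then show ?thesis
    using assms by (auto simp: split_cell_eq)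
qed

lemma split_cell_in_split: "r < k \<Longrightarrow> split_cell k \<alpha> \<beta> r \<in> split_of k \<alpha> \<beta>"
  unfolding split_of_def using convex_split_cell by (auto simp: face_of_refl)

lemma subdivision_of_split: "subdivision_of (split_of k \<alpha> \<beta>) simplex_product"
  unfolding subdivision_of_def
proof (intro conjI ballI allI impI)
  have "split_of k \<alpha> \<beta> = (\<Union>r<k. {F. F face_of split_cell k \<alpha> \<beta> r})"
    by (auto simp: split_of_def)
  then show "finite (split_of k \<alpha> \<beta>)"
    by (simp add: split_cell_def finite_polytope_faces polytope_edge_hull)
next
  fix C assume "C \<in> split_of k \<alpha> \<beta>"
  then show "polytope C" "verts C \<subseteq> verts simplex_product"
    unfolding split_of_def split_cell_def
    using face_of_polytope_polytope polytope_edge_hull verts_face_of_edge_hull by blast+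
next
  fix C F assume "C \<in> split_of k \<alpha> \<beta>" "F face_of C"
  then show "F \<in> split_of k \<alpha> \<beta>"
    unfolding split_of_def using face_of_trans by blast
next
  fix C D assume "C \<in> split_of k \<alpha> \<beta>" "D \<in> split_of k \<alpha> \<beta>"
  then obtain r s where rs: "r < k" "s < k" "C face_of split_cell k \<alpha> \<beta> r" "D face_of split_cell k \<alpha> \<beta> s"
    by (auto simp: split_of_def)
  then have "C \<inter> D face_of C \<and> C \<inter> D face_of D"
    using split_cell_Int_face[of r s] split_cell_Int_face[of s r]
    by (intro face_of_Int_subface[OF _ _ rs(3,4)]) (auto simp: Int_commute)
  then show "C \<inter> D face_of C" "C \<inter> D face_of D" by auto
next
  show "\<Union> (split_of k \<alpha> \<beta>) = simplex_product"
  proof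
    show "\<Union> (split_of k \<alpha> \<beta>) \<subseteq> simplex_product"
      using split_cell_subset by (auto simp: split_of_def dest: face_of_imp_subset)
    show "simplex_product \<subseteq> \<Union> (split_of k \<alpha> \<beta>)"
      using split_cells_cover split_cell_in_split by blast
  qed
qed

lemma split_cell_subset_iff:
  assumes "2 \<le> k" "r < k" "s < k"
  shows "split_cell k \<alpha> \<beta> r \<subseteq> split_cell k \<alpha> \<beta> s \<longleftrightarrow> r = s"
proof
  assume sub: "split_cell k \<alpha> \<beta> r \<subseteq> split_cell k \<alpha> \<beta> s"
  \<comment> \<open>The label before \<open>r\<close> on the circle; a vertex from \<open>r\<close>
    back to \<open>a\<close> lies in no cell but that of \<open>r\<close>.\<close>
  define a where "a = (if r = 0 then k - 1 else r - 1)"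
  have a: "a < k" "Suc a mod k = r"
    using assms by (auto simp: a_def)
  obtain i j where ij: "\<alpha> i = r" "\<beta> j = a"
    using ex_\<alpha> ex_\<beta> assms a by metis
  have "product_vertex i j \<in> split_cell k \<alpha> \<beta> r"
    using ij a assms cyc_le_Suc_left[of a k r] by (simp add: product_vertex_in_split_cell)
  then have "product_vertex i j \<in> split_cell k \<alpha> \<beta> s"
    using sub by blast
  then show "r = s"
    using ij a assms cyc_le_Suc_left[of a k s] by (simp add: product_vertex_in_split_cell)
qed simp

lemma maximal_cells_split:
  assumes "2 \<le> k"
  shows "maximal_cells (split_of k \<alpha> \<beta>) = split_cell k \<alpha> \<beta> ` {..<k}"
proof (intro equalityI subsetI)
  fix C assume C: "C \<in> maximal_cells (split_of k \<alpha> \<beta>)"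
  then obtain r where r: "r < k" "C face_of split_cell k \<alpha> \<beta> r"
    by (auto simp: maximal_cells_def split_of_def)
  then have "split_cell k \<alpha> \<beta> r = C"
    using C split_cell_in_split[of r] face_of_imp_subset[OF r(2)] unfolding maximal_cells_def by blast
  then show "C \<in> split_cell k \<alpha> \<beta> ` {..<k}" using r by auto
next
  fix C assume "C \<in> split_cell k \<alpha> \<beta> ` {..<k}"
  then obtain r where r: "r < k" "C = split_cell k \<alpha> \<beta> r" by auto
  have "D = C" if D: "D \<in> split_of k \<alpha> \<beta>" "C \<subseteq> D" for D
  proof -
    obtain s where s: "s < k" "D face_of split_cell k \<alpha> \<beta> s"
      using D by (auto simp: split_of_def)
    then have "D \<subseteq> split_cell k \<alpha> \<beta> s" by (simp add: face_of_imp_subset)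
    then have "r = s" using split_cell_subset_iff[OF assms r(1) s(1)] D r by auto
    then show ?thesis using D r \<open>D \<subseteq> _\<close> by auto
  qed
  then show "C \<in> maximal_cells (split_of k \<alpha> \<beta>)"
    using r split_cell_in_split by (auto simp: maximal_cells_def)
qed

lemma card_maximal_cells_split:
  assumes "2 \<le> k"
  shows "card (maximal_cells (split_of k \<alpha> \<beta>)) = k"
proof -
  have "inj_on (split_cell k \<alpha> \<beta>) {..<k}"
    using split_cell_subset_iff[OF assms] by (metis inj_onI lessThan_iff order_refl)
  then show ?thesis
    by (simp add: maximal_cells_split[OF assms] card_image)
qed

text \<open>This is the intersection of all the cells: where all heights are minimal they agree, and
  \<open>height 0\<close> is 0.\<close>

definition central_cell :: "((real ^ 'd) \<times> (real ^ 'l)) set" where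
  "central_cell = {p \<in> simplex_product. \<forall>q<k. height q p = 0}"

lemma product_vertex_in_central_cell: "product_vertex i j \<in> central_cell \<longleftrightarrow> \<alpha> i = \<beta> j"
proof
  assume "product_vertex i j \<in> central_cell"
  then have *: "height q (product_vertex i j) = 0" if "q < k" for q
    using that by (auto simp: central_cell_def)
  show "\<alpha> i = \<beta> j"
    using *[of "\<alpha> i"] *[of "\<beta> j"]
    by (auto simp: dominance_form_product_vertex split: if_splits)
qed (simp add: central_cell_def dominance_form_product_vertex)

lemma central_cell_subset: "r < k \<Longrightarrow> central_cell \<subseteq> split_cell k \<alpha> \<beta> r"
  by (auto simp: central_cell_def split_cell_eq)

text \<open>In the cell of 0 all heights are nonnegative, so the zero set of their sum is a face on
  which each of them vanishes.\<close>

lemma central_cell_in_split: "central_cell \<in> split_of k \<alpha> \<beta>"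
proof -
  have lin: "linear (\<lambda>p. \<Sum>q<k. height q p)"
    by (intro linear_compose_sum linear_dominance_form ballI)
  have nonneg: "0 \<le> height q p" if "p \<in> split_cell k \<alpha> \<beta> 0" "q < k" for p q
    using that k_pos by (auto simp: split_cell_eq)
  have "{p \<in> split_cell k \<alpha> \<beta> 0. (\<Sum>q<k. height q p) = 0} face_of split_cell k \<alpha> \<beta> 0"
    by (intro face_of_linear_zero_set lin convex_split_cell sum_nonneg nonneg) auto
  moreover have "(\<Sum>q<k. height q p) = 0 \<longleftrightarrow> (\<forall>q<k. height q p = 0)"
    if "p \<in> split_cell k \<alpha> \<beta> 0" for p
    using nonneg[OF that] by (subst sum_nonneg_eq_0_iff) auto
  then have "{p \<in> split_cell k \<alpha> \<beta> 0. (\<Sum>q<k. height q p) = 0} = central_cell"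
    using central_cell_subset[OF k_pos] split_cell_subset[of 0] by (auto simp: central_cell_def)
  ultimately show ?thesis
    using k_pos by (auto simp: split_of_def)
qed

lemma convex_central_cell: "convex central_cell"
  using central_cell_in_split by (auto simp: split_of_def dest: face_of_imp_convex)

text \<open>The witness is the mean of the vertices with equal labels. Each row and each column
  occurs in such a vertex because both labellings are onto.\<close>

lemma central_cell_meets_rel_interior: "central_cell \<inter> rel_interior simplex_product \<noteq> {}"
proof -
  define E where "E = {(i, j). \<alpha> i = \<beta> j}"
  define h where "h = (\<Sum>e\<in>E. (1 / real (card E)) *\<^sub>R product_vertex (fst e) (snd e))"
  have fin: "finite E" by simp
  have ne: "E \<noteq> {}"
  proof -
    obtain i j where "\<alpha> i = 0" "\<beta> j = 0"
      using ex_\<alpha> ex_\<beta> k_pos by metis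
    then have "(i, j) \<in> E" by (simp add: E_def)
    then show ?thesis by blast
  qed
  have hH: "h \<in> central_cell"
    unfolding h_def
    by (rule convex_sum) (use fin ne in \<open>auto simp: convex_central_cell product_vertex_in_central_cell E_def\<close>)
  have "0 < fst h $ i" for i
  proof -
    obtain j where "\<beta> j = \<alpha> i" using ex_\<beta> by (metis \<alpha>_less)
    then have "(i, j) \<in> E" by (simp add: E_def)
    then show ?thesis
      unfolding h_def fst_sum sum_component
      by (intro sum_pos2[OF fin]) (use fin ne in \<open>auto simp: product_vertex_def axis_def card_gt_0_iff\<close>)
  qed
  moreover have "0 < snd h $ j" for j
  proof -
    obtain i where "\<alpha> i = \<beta> j" using ex_\<alpha> by (metis \<beta>_less)
    then have "(i, j) \<in> E" by (simp add: E_def)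
    then show ?thesis
      unfolding h_def snd_sum sum_component
      by (intro sum_pos2[OF fin]) (use fin ne in \<open>auto simp: product_vertex_def axis_def card_gt_0_iff\<close>)
  qed
  ultimately have "h \<in> rel_interior simplex_product"
    using hH by (intro rel_interior_simplex_productI) (auto simp: central_cell_def)
  with hH show ?thesis by blast
qed

text \<open>Adding to \<open>H\<close> one vertex from label \<open>q\<close> to label
  \<open>q + 1\<close> for each \<open>q < k - 1\<close> raises the dimension by one each time, and
  exchanges then produce all other vertices. \<open>H\<close> is kept general so that this applies
  to the common cell of an arbitrary \<open>k\<close>-split too.\<close>

lemma aff_dim_simplex_product:
  assumes zero: "\<And>p q. p \<in> H \<Longrightarrow> q < k \<Longrightarrow> height q p = 0"
    and sub: "H \<subseteq> simplex_product"
    and diag: "\<And>i j. \<alpha> i = \<beta> j \<Longrightarrow> product_vertex i j \<in> affine hull H"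
  shows "aff_dim (simplex_product :: ((real ^ 'd) \<times> (real ^ 'l)) set) = aff_dim H + (int k - 1)"
proof -
  obtain I where I: "\<And>r. r < k \<Longrightarrow> \<alpha> (I r) = r" using ex_\<alpha> by metis
  obtain J where J: "\<And>r. r < k \<Longrightarrow> \<beta> (J r) = r" using ex_\<beta> by metis
  define w where "w q = product_vertex (I q) (J (Suc q))" for q
  have dim: "aff_dim (H \<union> w ` {..<n}) = aff_dim H + int n" if "n < k" for n
    using that
  proof (induction n)
    case (Suc n)
    \<comment> \<open>\<open>height (Suc n)\<close> is the separating form: it vanishes on
      \<open>H\<close> and on \<open>w q\<close> for \<open>q < n\<close>, but is 1 at
      \<open>w n\<close>.\<close>
    have "affine hull (H \<union> w ` {..<n}) \<subseteq> height (Suc n) -` {0}"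
    proof (rule hull_minimal)
      show "H \<union> w ` {..<n} \<subseteq> height (Suc n) -` {0}"
        using zero Suc.prems I J by (auto simp: w_def dominance_form_product_vertex)
      show "affine (height (Suc n) -` {0})"
        using linear_dominance_form[of \<alpha> \<beta> "Suc n"]
        by (auto simp: affine_def linear_add linear_scale)
    qed
    moreover have "height (Suc n) (w n) \<noteq> 0"
      using Suc.prems I J by (simp add: w_def dominance_form_product_vertex)
    ultimately have "w n \<notin> affine hull (H \<union> w ` {..<n})" by blast
    then show ?case
      using Suc by (simp add: lessThan_Suc aff_dim_insert)
  qed simp
  define N where "N = affine hull (H \<union> w ` {..<k - 1})"
  \<comment> \<open>The parallelogram relation is an affine combination with coefficients 1, 1,
    -1.\<close>
  have swap: "product_vertex i j' \<in> N"
    if "product_vertex i j \<in> N" "product_vertex i' j \<in> N" "product_vertex i' j' \<in> N" for i i' j j'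
  proof -
    have "product_vertex i j + 1 *\<^sub>R (product_vertex i' j' - product_vertex i' j) \<in> N"
      using that by (intro mem_affine_3_minus) (auto simp: N_def)
    then show ?thesis using product_vertex_parallelogram[of i j i' j'] by (simp add: algebra_simps)
  qed
  have diagN: "product_vertex i j \<in> N" if "\<alpha> i = \<beta> j" for i j
    using diag[OF that] hull_mono[of H "H \<union> w ` {..<k - 1}" affine] by (auto simp: N_def)
  have wN: "w q \<in> N" if "Suc q < k" for q
    using that by (auto simp: N_def intro!: hull_inc)
  \<comment> \<open>From the chosen representatives of the labels to arbitrary ones, by exchange
    with vertices of equal labels.\<close>
  have up: "product_vertex i j \<in> N" if "Suc q < k" "\<alpha> i = q" "\<beta> j = Suc q" for q i j
    using swap[of i "J q" "I q" "J (Suc q)"] swap[of i "J (Suc q)" "I (Suc q)" j] that I J diagN wN[of q]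
    by (simp add: w_def)
  have down: "product_vertex i j \<in> N" if "Suc q < k" "\<alpha> i = Suc q" "\<beta> j = q" for q i j
    using swap[of i "J (Suc q)" "I q" j] that I J diagN wN[of q] by (simp add: w_def)
  \<comment> \<open>Longer steps are composed of steps by one; the column \<open>J ?s\<close> and
    the row \<open>I ?s\<close> serve as the stop in between.\<close>
  have up': "product_vertex i j \<in> N" if "\<beta> j = \<alpha> i + n" for n i j
    using that
  proof (induction n arbitrary: j)
    case 0
    then show ?case by (simp add: diagN)
  next
    case (Suc n)
    let ?s = "\<alpha> i + n"
    have s: "Suc ?s < k" using Suc.prems \<beta>_less[of j] by simp
    show ?case
      using swap[of i "J ?s" "I ?s" j] Suc.IH[of "J ?s"] Suc.prems s I J diagN up[of ?s "I ?s" j] by simp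
  qed
  have down': "product_vertex i j \<in> N" if "\<alpha> i = \<beta> j + n" for n i j
    using that
  proof (induction n arbitrary: i)
    case 0
    then show ?case by (simp add: diagN)
  next
    case (Suc n)
    let ?s = "\<beta> j + n"
    have s: "Suc ?s < k" using Suc.prems \<alpha>_less[of i] by simp
    show ?case
      using swap[of i "J ?s" "I ?s" j] Suc.IH[of "I ?s"] Suc.prems s I J diagN down[of ?s i "J ?s"] by simp
  qed
  have "product_vertex i j \<in> N" for i j
    using up'[of j i "\<beta> j - \<alpha> i"] down'[of i j "\<alpha> i - \<beta> j"] by linarith
  then have "simplex_product \<subseteq> N"
    unfolding simplex_product_eq_edge_hull
    by (intro edge_hull_subset) (auto simp: N_def affine_imp_convex)
  moreover have "H \<union> w ` {..<k - 1} \<subseteq> simplex_product"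
    using sub by (auto simp: w_def)
  ultimately have "aff_dim (simplex_product :: ((real ^ 'd) \<times> (real ^ 'l)) set) = aff_dim (H \<union> w ` {..<k - 1})"
    by (metis N_def aff_dim_affine_hull aff_dim_subset antisym)
  then show ?thesis
    using dim[of "k - 1"] k_pos by simp
qed

end


section \<open>Subdivisions coarser than a split\<close>

lemma subdivision_cellD:
  assumes "subdivision_of T P" "C \<in> T"
  shows "polytope C" "convex C" "verts C \<subseteq> verts P" "C \<subseteq> P"
  using assms polytope_imp_convex unfolding subdivision_of_def by blast+

lemma subdivision_Int_face:
  "subdivision_of T P \<Longrightarrow> C \<in> T \<Longrightarrow> D \<in> T \<Longrightarrow> C \<inter> D face_of C"
  by (simp add: subdivision_of_def)

lemma subdivision_face_in: "subdivision_of T P \<Longrightarrow> C \<in> T \<Longrightarrow> F face_of C \<Longrightarrow> F \<in> T"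
  unfolding subdivision_of_def by blast

lemma subdivision_subset_imp_face:
  "subdivision_of T P \<Longrightarrow> C \<in> T \<Longrightarrow> D \<in> T \<Longrightarrow> C \<subseteq> D \<Longrightarrow> C face_of D"
  by (metis inf.absorb_iff1 inf_commute subdivision_Int_face)

lemma subdivision_rel_interior_subset:
  assumes "subdivision_of T P" "C \<in> T" "D \<in> T" "x \<in> rel_interior C" "x \<in> D"
  shows "C \<subseteq> D"
proof -
  have "C \<subseteq> C \<inter> D"
    using assms rel_interior_subset by (intro subset_of_face_of[OF subdivision_Int_face]) auto
  then show ?thesis by auto
qed

lemma subdivision_containing_whole:
  assumes T: "subdivision_of T P" and P: "P \<in> T"
  shows "T = trivial_subdivision P"
  using subdivision_subset_imp_face[OF T _ P] subdivision_cellD(4)[OF T] subdivision_face_in[OF T P]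
  by (auto simp: trivial_subdivision_def)

lemma subdivision_cell_eq_edge_hull:
  "subdivision_of T simplex_product \<Longrightarrow> C \<in> T \<Longrightarrow> C = edge_hull (\<lambda>i j. product_vertex i j \<in> C)"
  using polytope_eq_edge_hull subdivision_cellD by blast

text \<open>The edges \<open>ij\<close>, \<open>i'j'\<close> and the edges \<open>ij'\<close>, \<open>i'j\<close> have the same midpoint. It lies in \<open>C\<close> and
  inside the segment from a vertex of \<open>D\<close> to another one.\<close>

lemma subdivision_swap:
  assumes T: "subdivision_of T simplex_product"
    and C: "C \<in> T" "product_vertex i j \<in> C" "product_vertex i' j' \<in> C"
    and D: "D \<in> T" "product_vertex i j' \<in> D" "product_vertex i' j \<in> D"
  shows "product_vertex i j' \<in> C" "product_vertex i' j \<in> C"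
proof -
  let ?m = "(1 - 1/2) *\<^sub>R product_vertex i j' + (1/2) *\<^sub>R product_vertex i' j :: (real ^ 'a) \<times> (real ^ 'b)"
  have "?m = (1/2) *\<^sub>R product_vertex i j + (1/2) *\<^sub>R product_vertex i' j'"
    using product_vertex_parallelogram[of i j i' j']
    by (metis add_diff_cancel_left' field_sum_of_halves scaleR_right_distrib)
  also have "\<dots> \<in> C"
    using subdivision_cellD(2)[OF T C(1)] C by (intro convexD) auto
  finally have "?m \<in> C" .
  moreover have "?m \<in> D"
    using subdivision_cellD(2)[OF T D(1)] D by (intro convexD) auto
  ultimately have m: "?m \<in> D \<inter> C" by blast
  have "product_vertex i j' \<in> D \<inter> C \<and> product_vertex i' j \<in> D \<inter> C"
    using face_of_contains_endpoint[OF subdivision_Int_face[OF T D(1) C(1)] D(2,3) _ _ m] by simp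
  then show "product_vertex i j' \<in> C" "product_vertex i' j \<in> C" by auto
qed

text \<open>As a residue of an integer difference, the position is open to modular arithmetic
  without truncation.\<close>

lemma int_cyc_position:
  fixes a k r :: nat
  assumes "r \<le> k"
  shows "int ((a + k - r) mod k) = (int a - int r) mod int k"
proof -
  have "int (a + k - r) = int a - int r + int k"
    using assms by simp
  then show ?thesis
    by (simp add: of_nat_mod)
qed

context labelling
begin

text \<open>Two cells together contain every step to the next label. Inside \<open>D\<close> such
  steps can be composed all the way around the circle, which yields all vertices of the
  product.\<close>

lemma coarser_cell_eq_simplex_product:
  assumes T: "subdivision_of T simplex_product"
    and coarser: "\<And>r. r < k \<Longrightarrow> \<exists>D\<in>T. split_cell k \<alpha> \<beta> r \<subseteq> D"
    and D: "D \<in> T" "split_cell k \<alpha> \<beta> m \<subseteq> D" "split_cell k \<alpha> \<beta> n \<subseteq> D"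
    and mn: "m < k" "n < k" "m \<noteq> n"
  shows "D = simplex_product"
proof -
  \<comment> \<open>The wanted vertex lies in some split cell, together with the vertex
    \<open>i'j\<close> of equal labels. A cell of \<open>T\<close> contains both, so the exchange
    rule for subdivisions applies.\<close>
  have swap: "product_vertex i j' \<in> D"
    if "product_vertex i j \<in> D" "product_vertex i' j' \<in> D" "\<alpha> i' = \<beta> j" for i j i' j'
  proof -
    obtain r where r: "r < k" "product_vertex i j' \<in> split_cell k \<alpha> \<beta> r"
      using split_cells_cover[of "product_vertex i j'"] by auto
    then obtain D' where "D' \<in> T" "split_cell k \<alpha> \<beta> r \<subseteq> D'" using coarser by blast
    moreover have "product_vertex i' j \<in> split_cell k \<alpha> \<beta> r"
      using r that(3) by (simp add: product_vertex_in_split_cell cyc_le_def)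
    ultimately show ?thesis
      using subdivision_swap(1)[OF T D(1) that(1,2)] r by blast
  qed
  have arc: "product_vertex i j \<in> D" if ij: "\<beta> j = Suc (\<alpha> i) mod k" for i j
  proof -
    have "m \<noteq> \<beta> j \<or> n \<noteq> \<beta> j" using mn by auto
    then have "cyc_le k m (\<alpha> i) (\<beta> j) \<or> cyc_le k n (\<alpha> i) (\<beta> j)"
      using mn ij cyc_le_Suc[of "\<alpha> i" k] by auto
    then show ?thesis
      using D mn product_vertex_in_split_cell by blast
  qed
  have "product_vertex i j \<in> D" if "\<beta> j = (\<alpha> i + t) mod k" for i j t
    using that
  proof (induction t arbitrary: j)
    case 0
    then show ?case
      using D(2) mn(1) product_vertex_in_split_cell[of m i j] by (auto simp: cyc_le_def)
  next
    case (Suc t)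
    let ?s = "(\<alpha> i + t) mod k"
    have s: "?s < k" using k_pos by simp
    obtain j' i' where "\<beta> j' = ?s" "\<alpha> i' = ?s"
      using ex_\<alpha>[OF s] ex_\<beta>[OF s] by blast
    moreover from this have "\<beta> j = Suc (\<alpha> i') mod k"
      using Suc.prems by (simp add: mod_Suc_eq)
    ultimately show ?case
      using swap[of i j' i' j] arc[of j i'] Suc.IH[of j'] by simp
  qed
  moreover have "\<beta> j = (\<alpha> i + (\<beta> j + k - \<alpha> i)) mod k" for i j
  proof -
    have "\<alpha> i + (\<beta> j + k - \<alpha> i) = \<beta> j + k"
      using \<alpha>_less[of i] by linarith
    then show ?thesis by simp
  qed
  ultimately have "\<And>i j. product_vertex i j \<in> D" by blast
  then have "simplex_product \<subseteq> D"
    unfolding simplex_product_eq_edge_hull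
    by (intro edge_hull_subset subdivision_cellD(2)[OF T D(1)])
  then show ?thesis
    using subdivision_cellD(4)[OF T D(1)] by blast
qed

text \<open>In a nontrivial coarser subdivision no cell contains two split cells. This forces each
  cell above a split cell to be that split cell, so nothing has been coarsened.\<close>

lemma coarsest_split:
  assumes k: "2 \<le> k"
  shows "coarsest_subdivision (split_of k \<alpha> \<beta>) simplex_product"
  unfolding coarsest_subdivision_def
proof (intro conjI allI impI)
  show "subdivision_of (split_of k \<alpha> \<beta>) simplex_product"
    by (rule subdivision_of_split)
  show "split_of k \<alpha> \<beta> \<noteq> trivial_subdivision simplex_product"
  proof
    assume "split_of k \<alpha> \<beta> = trivial_subdivision simplex_product"
    then have "simplex_product \<in> split_of k \<alpha> \<beta>"
      using face_of_refl[OF convex_simplex_product] by (auto simp: trivial_subdivision_def)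
    then obtain r where r: "r < k" "simplex_product \<subseteq> split_cell k \<alpha> \<beta> r"
      by (auto simp: split_of_def dest: face_of_imp_subset)
    define s where "s = (if r = 0 then 1 else 0 :: nat)"
    have "s < k" "s \<noteq> r" using k by (auto simp: s_def)
    then show False
      using split_cell_subset_iff[OF k \<open>s < k\<close> r(1)] split_cell_subset[of s] r(2) by blast
  qed
next
  fix T :: "((real ^ 'd) \<times> (real ^ 'l)) set set"
  assume "subdivision_of T simplex_product \<and> strictly_coarser T (split_of k \<alpha> \<beta>)"
  then have T: "subdivision_of T simplex_product" and neq: "T \<noteq> split_of k \<alpha> \<beta>"
    and coarser: "\<And>r. r < k \<Longrightarrow> \<exists>D\<in>T. split_cell k \<alpha> \<beta> r \<subseteq> D"
    using split_cell_in_split by (auto simp: strictly_coarser_def)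
  show "T = trivial_subdivision simplex_product"
  proof (rule ccontr)
    assume nontrivial: "T \<noteq> trivial_subdivision simplex_product"
    have single: "m = n"
      if "D \<in> T" "m < k" "n < k" "split_cell k \<alpha> \<beta> m \<subseteq> D" "split_cell k \<alpha> \<beta> n \<subseteq> D" for D m n
      using coarser_cell_eq_simplex_product[OF T coarser that(1,4,5,2,3)] nontrivial
        subdivision_containing_whole[OF T] that(1) by blast
    have eq: "D = split_cell k \<alpha> \<beta> m" if D: "D \<in> T" "m < k" "split_cell k \<alpha> \<beta> m \<subseteq> D" for D m
    proof (rule antisym)
      \<comment> \<open>A point \<open>x\<close> of the relative interior lies in some split cell
        \<open>n\<close>. The cell of \<open>T\<close> around it contains \<open>D\<close>, hence
        the split cells \<open>m\<close> and \<open>n\<close>, so \<open>n = m\<close>. Taking the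
        closure then bounds \<open>D\<close>.\<close>
      have "rel_interior D \<subseteq> split_cell k \<alpha> \<beta> m"
      proof
        fix x assume x: "x \<in> rel_interior D"
        then have "x \<in> simplex_product"
          using rel_interior_subset subdivision_cellD(4)[OF T D(1)] by blast
        then obtain n where n: "n < k" "x \<in> split_cell k \<alpha> \<beta> n"
          using split_cells_cover by blast
        then obtain D' where D': "D' \<in> T" "split_cell k \<alpha> \<beta> n \<subseteq> D'" using coarser by blast
        then have "D \<subseteq> D'"
          using subdivision_rel_interior_subset[OF T D(1) D'(1) x] n by blast
        then have "m = n"
          using single[OF D'(1) D(2) n(1)] D D' by blast
        then show "x \<in> split_cell k \<alpha> \<beta> m" using n by simp
      qed
      then have "closure (rel_interior D) \<subseteq> split_cell k \<alpha> \<beta> m"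
        by (intro closure_minimal) (simp_all add: split_cell_def polytope_edge_hull polytope_imp_closed)
      then show "D \<subseteq> split_cell k \<alpha> \<beta> m"
        using convex_closure_rel_interior[OF subdivision_cellD(2)[OF T D(1)]] closure_subset by blast
    qed (rule D(3))
    have in_T: "split_cell k \<alpha> \<beta> m \<in> T" if "m < k" for m
      using coarser[OF that] eq[OF _ that] by blast
    have "C \<in> split_of k \<alpha> \<beta>" if C: "C \<in> T" for C
    proof (cases "C = {}")
      case True
      then show ?thesis using k_pos by (auto simp: split_of_def)
    next
      case False
      then obtain x where x: "x \<in> rel_interior C"
        using rel_interior_eq_empty[OF subdivision_cellD(2)[OF T C]] by blast
      then have "x \<in> simplex_product"
        using rel_interior_subset subdivision_cellD(4)[OF T C] by blast
      then obtain m where m: "m < k" "x \<in> split_cell k \<alpha> \<beta> m"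
        using split_cells_cover by blast
      then have "C face_of split_cell k \<alpha> \<beta> m"
        using subdivision_rel_interior_subset[OF T C in_T x] subdivision_subset_imp_face[OF T C in_T] by blast
      then show ?thesis using m by (auto simp: split_of_def)
    qed
    moreover have "C \<in> T" if "C \<in> split_of k \<alpha> \<beta>" for C
      using that subdivision_face_in[OF T in_T] by (auto simp: split_of_def)
    ultimately show False using neq by blast
  qed
qed

lemma k_split_split:
  assumes k: "2 \<le> k"
  shows "k_split k (split_of k \<alpha> \<beta>) simplex_product"
  unfolding k_split_def
proof (intro conjI bexI[of _ central_cell])
  show "\<forall>C\<in>maximal_cells (split_of k \<alpha> \<beta>). central_cell \<subseteq> C"
    using central_cell_subset by (auto simp: maximal_cells_split[OF k])
  have "aff_dim (simplex_product :: ((real ^ 'd) \<times> (real ^ 'l)) set) = aff_dim central_cell + (int k - 1)"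
    by (rule aff_dim_simplex_product)
       (auto simp: central_cell_def product_vertex_in_central_cell intro!: hull_inc, simp add: dominance_form_product_vertex)
  then show "aff_dim central_cell = aff_dim (simplex_product :: ((real ^ 'd) \<times> (real ^ 'l)) set) - (int k - 1)"
    by simp
qed (rule coarsest_split[OF k] card_maximal_cells_split[OF k] central_cell_in_split
      central_cell_meets_rel_interior)+

text \<open>An invariant that shows \<beta> j - \<alpha> i modulo \<open>k\<close>: the vertex is
  missing exactly from the cells whose start lies after \<alpha> i and not after \<beta> j on the
  circle.\<close>

lemma card_maximal_cells_containing:
  assumes k: "2 \<le> k"
  shows "card {C \<in> maximal_cells (split_of k \<alpha> \<beta>). product_vertex i j \<in> C}
    = k - (\<beta> j + k - \<alpha> i) mod k"
proof -
  have "{C \<in> maximal_cells (split_of k \<alpha> \<beta>). product_vertex i j \<in> C}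
      = split_cell k \<alpha> \<beta> ` {r. r < k \<and> cyc_le k r (\<alpha> i) (\<beta> j)}"
    using product_vertex_in_split_cell by (auto simp: maximal_cells_split[OF k])
  moreover have "inj_on (split_cell k \<alpha> \<beta>) {r. r < k \<and> cyc_le k r (\<alpha> i) (\<beta> j)}"
    using split_cell_subset_iff[OF k] by (intro inj_onI) auto
  ultimately have "card {C \<in> maximal_cells (split_of k \<alpha> \<beta>). product_vertex i j \<in> C}
      = card {r. r < k \<and> cyc_le k r (\<alpha> i) (\<beta> j)}"
    by (simp add: card_image)
  also have "\<dots> = k - (\<beta> j + k - \<alpha> i) mod k"
  proof (cases "\<alpha> i \<le> \<beta> j")
    case True
    then have "{r. r < k \<and> cyc_le k r (\<alpha> i) (\<beta> j)} = {..\<alpha> i} \<union> {\<beta> j<..<k}"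
      using \<alpha>_less[of i] \<beta>_less[of j] by (auto simp: cyc_le_iff simp del: \<alpha>_less \<beta>_less)
    moreover have "card ({..\<alpha> i} \<union> {\<beta> j<..<k}) = Suc (\<alpha> i) + (k - Suc (\<beta> j))"
      using True by (subst card_Un_disjoint) auto
    moreover have "(\<beta> j + k - \<alpha> i) mod k = \<beta> j - \<alpha> i"
      using True by (simp add: cyc_position)
    moreover have "Suc (\<alpha> i) + (k - Suc (\<beta> j)) = k - (\<beta> j - \<alpha> i)"
      using True \<beta>_less[of j] by linarith
    ultimately show ?thesis
      by (simp only:)
  next
    case False
    then have "{r. r < k \<and> cyc_le k r (\<alpha> i) (\<beta> j)} = {\<beta> j<..\<alpha> i}"
      using \<alpha>_less[of i] \<beta>_less[of j] by (auto simp: cyc_le_iff simp del: \<alpha>_less \<beta>_less)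
    moreover have "(\<beta> j + k - \<alpha> i) mod k = \<beta> j + k - \<alpha> i"
      using False by (simp add: cyc_position)
    moreover have "\<alpha> i - \<beta> j = k - (\<beta> j + k - \<alpha> i)"
      using False \<alpha>_less[of i] by linarith
    ultimately show ?thesis
      by (simp only: card_greaterThanAtMost)
  qed
  finally show ?thesis .
qed

end

text \<open>Positions depend only on differences modulo \<open>k\<close>, so adding \<open>n\<close>
  to all labels merely permutes the cells.\<close>

lemma (in labelling) split_of_rotate:
  "split_of k (\<lambda>i. (\<alpha> i + n) mod k) (\<lambda>j. (\<beta> j + n) mod k) = split_of k \<alpha> \<beta>"
proof -
  have pos: "((\<gamma> + n) mod k + k - (r + n) mod k) mod k = (\<gamma> + k - r) mod k" if "r < k" for \<gamma> r
  proof -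
    have "int (((\<gamma> + n) mod k + k - (r + n) mod k) mod k) = (int (\<gamma> + n) - int (r + n)) mod int k"
      using k_pos by (subst int_cyc_position) (simp_all add: less_imp_le of_nat_mod mod_simps del: of_nat_add)
    also have "\<dots> = int ((\<gamma> + k - r) mod k)"
      using that by (subst int_cyc_position) simp_all
    finally show ?thesis by simp
  qed
  have cell: "split_cell k (\<lambda>i. (\<alpha> i + n) mod k) (\<lambda>j. (\<beta> j + n) mod k) ((r + n) mod k) = split_cell k \<alpha> \<beta> r"
    if "r < k" for r
    using pos[OF that] by (simp add: split_cell_def cyc_le_def)
  have "bij_betw (\<lambda>r. (r + n) mod k) {..<k} {..<k}"
  proof -
    have "inj_on (\<lambda>r. (r + n) mod k) {..<k}"
    proof (rule inj_onI)
      fix r s assume "r \<in> {..<k}" "s \<in> {..<k}" "(r + n) mod k = (s + n) mod k"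
      then have "(r + n) mod k + k - (0 + n) mod k = (s + n) mod k + k - (0 + n) mod k" by simp
      then have "(r + k) mod k = (s + k) mod k"
        using pos[OF k_pos, of r] pos[OF k_pos, of s] by simp
      then show "r = s" using \<open>r \<in> _\<close> \<open>s \<in> _\<close> by simp
    qed
    moreover have "(\<lambda>r. (r + n) mod k) ` {..<k} \<subseteq> {..<k}" using k_pos by auto
    ultimately show ?thesis
      by (simp add: bij_betw_def endo_inj_surj)
  qed
  then have image: "(\<lambda>r. (r + n) mod k) ` {..<k} = {..<k}"
    by (simp add: bij_betw_def)
  have split: "split_of k \<gamma> \<delta> = (\<Union>r\<in>{..<k}. {F. F face_of split_cell k \<gamma> \<delta> r})"
    for \<gamma> :: "'d \<Rightarrow> nat" and \<delta> :: "'l \<Rightarrow> nat"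
    by (auto simp: split_of_def)
  show ?thesis
    unfolding split by (subst image[symmetric]) (simp add: cell)
qed

text \<open>Equal splits have equal counts of cells at each vertex, hence equal differences of
  labels modulo \<open>k\<close>.\<close>

lemma split_of_eq_imp_rotate:
  assumes k: "2 \<le> k" and lab: "labelling k \<alpha> \<beta>" "labelling k \<alpha>' \<beta>'"
    and eq: "split_of k \<alpha> \<beta> = split_of k \<alpha>' \<beta>'"
  shows "\<exists>n. \<alpha>' = (\<lambda>i. (\<alpha> i + n) mod k) \<and> \<beta>' = (\<lambda>j. (\<beta> j + n) mod k)"
proof -
  interpret A: labelling k \<alpha> \<beta> by fact
  interpret B: labelling k \<alpha>' \<beta>' by fact
  have "k - (\<beta> j + k - \<alpha> i) mod k = k - (\<beta>' j + k - \<alpha>' i) mod k" for i j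
    using A.card_maximal_cells_containing[OF k, of i j] B.card_maximal_cells_containing[OF k, of i j] eq
    by simp
  then have "(\<beta> j + k - \<alpha> i) mod k = (\<beta>' j + k - \<alpha>' i) mod k" for i j
    by (metis A.k_pos diff_diff_cancel less_imp_le mod_less_divisor)
  then have "int ((\<beta> j + k - \<alpha> i) mod k) = int ((\<beta>' j + k - \<alpha>' i) mod k)" for i j
    by simp
  then have diff: "(int (\<beta> j) - int (\<alpha> i)) mod int k = (int (\<beta>' j) - int (\<alpha>' i)) mod int k" for i j
    using int_cyc_position[of "\<alpha> i" k "\<beta> j"] int_cyc_position[of "\<alpha>' i" k "\<beta>' j"]
      A.\<alpha>_less[of i] B.\<alpha>_less[of i]
    by (metis less_imp_le)
  \<comment> \<open>The rotation is read off at a row of label 0: its new label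
    \<open>\<alpha>' i0\<close> is the amount \<open>n\<close>.\<close>
  obtain i0 j0 where z: "\<alpha> i0 = 0" "\<beta> j0 = 0"
    using A.ex_\<alpha>[OF A.k_pos] A.ex_\<beta>[OF A.k_pos] by blast
  have b: "\<beta>' j = (\<beta> j + \<alpha>' i0) mod k" for j
  proof -
    have "int (\<beta>' j) mod int k = (int (\<beta> j) + int (\<alpha>' i0)) mod int k"
      using mod_add_cong[OF diff[of j i0] refl[of "int (\<alpha>' i0) mod int k"]] z by simp
    then have "int (\<beta>' j mod k) = int ((\<beta> j + \<alpha>' i0) mod k)" by (simp add: of_nat_mod)
    then show ?thesis by simp
  qed
  have a: "\<alpha>' i = (\<alpha> i + \<alpha>' i0) mod k" for i
  proof -
    have "\<beta>' j0 = \<alpha>' i0" using b[of j0] z by simp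
    then have "(int (\<alpha>' i0) - (int (\<beta>' j0) - int (\<alpha>' i))) mod int k
        = (int (\<alpha>' i0) - (int (\<beta> j0) - int (\<alpha> i))) mod int k"
      using mod_diff_cong[OF refl[of "int (\<alpha>' i0) mod int k"] diff[of j0 i]] by simp
    then have "int (\<alpha>' i mod k) = int ((\<alpha> i + \<alpha>' i0) mod k)"
      using z \<open>\<beta>' j0 = \<alpha>' i0\<close> by (simp add: of_nat_mod add.commute)
    then show ?thesis by simp
  qed
  show ?thesis using a b by blast
qed


section \<open>The cyclic order of a k-split\<close>

text \<open>Counting strict predecessors turns a finite linear order into the order of numbers: the
  larger element has all predecessors of the smaller one and the smaller one itself.\<close>

lemma card_initial_segment_less:
  assumes lin: "\<And>a b. a \<in> A \<Longrightarrow> b \<in> A \<Longrightarrow> L a b \<or> L b a"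
    "\<And>a b. a \<in> A \<Longrightarrow> b \<in> A \<Longrightarrow> L a b \<Longrightarrow> L b a \<Longrightarrow> a = b"
    "\<And>a b c. a \<in> A \<Longrightarrow> b \<in> A \<Longrightarrow> c \<in> A \<Longrightarrow> L a b \<Longrightarrow> L b c \<Longrightarrow> L a c"
    and A: "finite A" "a \<in> A" "b \<in> A" "L a b" "a \<noteq> b"
  shows "card {x \<in> A. x \<noteq> a \<and> L x a} < card {x \<in> A. x \<noteq> b \<and> L x b}"
proof (rule psubset_card_mono)
  have "{x \<in> A. x \<noteq> a \<and> L x a} \<subseteq> {x \<in> A. x \<noteq> b \<and> L x b}"
    using lin A(2-) by blast
  moreover have "a \<in> {x \<in> A. x \<noteq> b \<and> L x b}" "a \<notin> {x \<in> A. x \<noteq> a \<and> L x a}"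
    using A by auto
  ultimately show "{x \<in> A. x \<noteq> a \<and> L x a} \<subset> {x \<in> A. x \<noteq> b \<and> L x b}"
    by blast
qed (use A in simp)

text \<open>Read \<open>Q r a b\<close> as: going around a circle from \<open>r\<close>, one meets \<open>a\<close> not later than \<open>b\<close>.\<close>

lemma cyclic_order_positions:
  fixes Q :: "nat \<Rightarrow> nat \<Rightarrow> nat \<Rightarrow> bool"
  assumes refl: "\<And>r a. r < k \<Longrightarrow> a < k \<Longrightarrow> Q r a a"
    and source: "\<And>r a. r < k \<Longrightarrow> a < k \<Longrightarrow> Q r r a"
    and antisym: "\<And>r a b. r < k \<Longrightarrow> a < k \<Longrightarrow> b < k \<Longrightarrow> Q r a b \<Longrightarrow> Q r b a \<Longrightarrow> a = b"
    and trans: "\<And>r a b c. r < k \<Longrightarrow> a < k \<Longrightarrow> b < k \<Longrightarrow> c < k \<Longrightarrow> Q r a b \<Longrightarrow> Q r b c \<Longrightarrow> Q r a c"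
    and xor: "\<And>r a b. r < k \<Longrightarrow> a < k \<Longrightarrow> b < k \<Longrightarrow> distinct [r, a, b] \<Longrightarrow> Q r a b \<noteq> Q a r b"
  shows "\<exists>\<sigma>. bij_betw \<sigma> {..<k} {..<k} \<and>
    (\<forall>r<k. \<forall>a<k. \<forall>b<k. Q r a b \<longleftrightarrow> cyc_le k (\<sigma> r) (\<sigma> a) (\<sigma> b))"
proof -
  \<comment> \<open>Turns the exclusive alternative \<open>xor\<close> into invariance under
    rotation of three distinct labels, the usual axiom of a cyclic order.\<close>
  have rotate: "Q a b r" "Q b r a"
    if "r < k" "a < k" "b < k" "distinct [r, a, b]" "Q r a b" for r a b
  proof -
    have neq: "r \<noteq> a" "r \<noteq> b" "a \<noteq> b" using that by auto
    have "\<not> Q r b a" using antisym that neq by blast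
    then show 1: "Q b r a" using xor[of r b a] that neq by auto
    then have "\<not> Q b a r" using antisym that neq by blast
    then show "Q a b r" using xor[of b a r] that neq by auto
  qed
  have total: "Q r a b \<or> Q r b a" if "r < k" "a < k" "b < k" for r a b
  proof (cases "distinct [r, a, b]")
    case True
    then show ?thesis
      using xor[OF that True] rotate(1)[of a r b] that True by auto
  qed (use that refl source in auto)
  \<comment> \<open>The circle is cut in front of 0, which makes \<open>Q 0\<close> a linear order;
    \<sigma> numbers the labels along it.\<close>
  define \<sigma> where "\<sigma> a = card {x \<in> {..<k}. x \<noteq> a \<and> Q 0 x a}" for a
  have less: "\<sigma> a < \<sigma> b" if "a < k" "b < k" "Q 0 a b" "a \<noteq> b" for a b
    unfolding \<sigma>_def
  proof (rule card_initial_segment_less)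
    have "0 < k" using that(1) by simp
    show "x = y" if "x \<in> {..<k}" "y \<in> {..<k}" "Q 0 x y" "Q 0 y x" for x y
      using that antisym[OF \<open>0 < k\<close>] by simp
    show "Q 0 x z" if "x \<in> {..<k}" "y \<in> {..<k}" "z \<in> {..<k}" "Q 0 x y" "Q 0 y z" for x y z
      using that trans[OF \<open>0 < k\<close>, of x y z] by simp
    show "Q 0 x y \<or> Q 0 y x" if "x \<in> {..<k}" "y \<in> {..<k}" for x y
      using that total[OF \<open>0 < k\<close>] by simp
  qed (use that in auto)
  have le_iff: "\<sigma> a \<le> \<sigma> b \<longleftrightarrow> Q 0 a b" if "a < k" "b < k" for a b
  proof -
    have "0 < k" using that by simp
    then show ?thesis
      using less[of a b] less[of b a] that total[of 0 a b] refl[of 0 a] by (metis leD le_less_linear less_imp_le order_refl)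
  qed
  have inj: "inj_on \<sigma> {..<k}"
  proof (rule inj_onI)
    fix a b assume "a \<in> {..<k}" "b \<in> {..<k}" "\<sigma> a = \<sigma> b"
    then show "a = b"
      using le_iff[of a b] le_iff[of b a] antisym[of 0 a b] by simp
  qed
  have lt: "\<sigma> a < k" if "a < k" for a
  proof -
    have "\<sigma> a \<le> card ({..<k} - {a})"
      unfolding \<sigma>_def by (rule card_mono) auto
    then show ?thesis using that by simp
  qed
  have bij: "bij_betw \<sigma> {..<k} {..<k}"
    unfolding bij_betw_def
    using inj lt endo_inj_surj[of "{..<k}" \<sigma>] by (simp add: image_subset_iff)
  \<comment> \<open>Transfers the order seen from 0 to the order seen from \<open>x\<close>. If
    \<open>z\<close> came before \<open>y\<close> from \<open>x\<close>, then from \<open>y\<close>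
    one would meet \<open>x\<close> before \<open>z\<close> before 0; rotated to \<open>x\<close>,
    this puts 0 before \<open>y\<close>, although \<open>x\<close> before \<open>y\<close> from 0
    puts \<open>y\<close> before 0.\<close>
  have sorted: "Q x y z" if "x < k" "y < k" "z < k" "\<sigma> x < \<sigma> y" "\<sigma> y < \<sigma> z" for x y z
  proof (cases "x = 0")
    case True
    then show ?thesis using le_iff[of y z] that by simp
  next
    case False
    have neq: "x \<noteq> y" "y \<noteq> z" "x \<noteq> z" using that by auto
    have 0: "0 < k" using that by simp
    have min: "\<sigma> 0 \<le> \<sigma> a" if "a < k" for a
      using le_iff[OF 0 that] source[OF 0 that] by simp
    have neq0: "y \<noteq> 0" "z \<noteq> 0" using min[of x] that by (metis leD less_trans)+
    have L: "Q 0 x y" "Q 0 y z" "Q 0 x z" using that by (auto simp flip: le_iff)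
    show ?thesis
    proof (rule ccontr)
      assume "\<not> Q x y z"
      then have "Q x z y" using total that by blast
      then have "Q y x z" using rotate(2)[of x z y] that neq by auto
      moreover have "Q y z 0" using rotate(1)[of 0 y z] L 0 that neq neq0 by auto
      ultimately have "Q y x 0" using trans[of y x z 0] that 0 by auto
      then have "Q x 0 y" using rotate(1)[of y x 0] 0 that neq neq0 False by auto
      moreover have "Q x y 0" using rotate(1)[of 0 x y] L 0 that neq neq0 False by auto
      ultimately show False using antisym[of x 0 y] 0 that neq0 by auto
    qed
  qed
  have sorted': "Q x y z" "Q y z x" "Q z x y" "\<not> Q x z y" "\<not> Q y x z" "\<not> Q z y x"
    if xyz: "x < k" "y < k" "z < k" "\<sigma> x < \<sigma> y" "\<sigma> y < \<sigma> z" for x y z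
  proof -
    have d: "distinct [x, y, z]" using xyz by auto
    show Q: "Q x y z" "Q y z x" "Q z x y"
      using sorted[OF xyz] rotate[OF xyz(1-3) d] by auto
    show "\<not> Q x z y" "\<not> Q y x z" "\<not> Q z y x"
      using Q antisym xyz(1-3) d by (metis distinct_length_2_or_more)+
  qed
  have "Q r a b \<longleftrightarrow> cyc_le k (\<sigma> r) (\<sigma> a) (\<sigma> b)" if "r < k" "a < k" "b < k" for r a b
  proof -
    have inj': "\<sigma> x \<noteq> \<sigma> y" if "x < k" "y < k" "x \<noteq> y" for x y
      using that inj by (auto simp: inj_on_def)
    have cyc: "cyc_le k (\<sigma> r) (\<sigma> a) (\<sigma> b) \<longleftrightarrow>
        (if \<sigma> a \<le> \<sigma> b then \<sigma> r \<le> \<sigma> a \<or> \<sigma> b < \<sigma> r else \<sigma> b < \<sigma> r \<and> \<sigma> r \<le> \<sigma> a)"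
      using that lt by (intro cyc_le_iff) auto
    consider "a = b" | "r = a" | "r = b" "a \<noteq> b" | "distinct [r, a, b]" by auto
    then show ?thesis
    proof cases
      case 1
      then show ?thesis using cyc refl that by (auto simp: not_le)
    next
      case 2
      then show ?thesis using cyc source that by auto
    next
      case 3
      then show ?thesis using cyc antisym[of b a b] source[of b a] inj'[of a b] that by auto
    next
      case 4
      then have "\<sigma> r \<noteq> \<sigma> a" "\<sigma> r \<noteq> \<sigma> b" "\<sigma> a \<noteq> \<sigma> b" using inj' that by auto
      then consider "\<sigma> r < \<sigma> a" "\<sigma> a < \<sigma> b" | "\<sigma> r < \<sigma> b" "\<sigma> b < \<sigma> a" | "\<sigma> a < \<sigma> r" "\<sigma> r < \<sigma> b"
        | "\<sigma> a < \<sigma> b" "\<sigma> b < \<sigma> r" | "\<sigma> b < \<sigma> r" "\<sigma> r < \<sigma> a" | "\<sigma> b < \<sigma> a" "\<sigma> a < \<sigma> r"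
        by linarith
      then show ?thesis
        by cases (use cyc sorted' that in auto)
    qed
  qed
  with bij show ?thesis by blast
qed

text \<open>The rows have neighbourhoods that are equal or disjoint. Numbering the neighbourhoods
  labels the rows, and a column takes the label of any row related to it.\<close>

lemma difunctional_labelling:
  fixes E :: "'d::finite \<Rightarrow> 'l::finite \<Rightarrow> bool"
  assumes left: "\<And>i. \<exists>j. E i j" and right: "\<And>j. \<exists>i. E i j"
    and difun: "\<And>i j i' j'. E i j \<Longrightarrow> E i' j \<Longrightarrow> E i' j' \<Longrightarrow> E i j'"
  shows "\<exists>k \<alpha> \<beta>. labelling k \<alpha> \<beta> \<and> (\<forall>i j. E i j \<longleftrightarrow> \<alpha> i = \<beta> j)"
proof -
  define cls where "cls i = {j. E i j}" for i
  obtain e where e: "bij_betw e (range cls) {0..<card (range cls)}"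
    using ex_bij_betw_finite_nat[of "range cls"] by auto
  obtain f where f: "\<And>j. E (f j) j" using right by metis
  define \<alpha> where "\<alpha> i = e (cls i)" for i
  define \<beta> where "\<beta> j = e (cls (f j))" for j
  have iff: "E i j \<longleftrightarrow> \<alpha> i = \<beta> j" for i j
  proof -
    have "\<alpha> i = \<beta> j \<longleftrightarrow> cls i = cls (f j)"
      using e unfolding \<alpha>_def \<beta>_def bij_betw_def by (auto dest: inj_onD)
    also have "\<dots> \<longleftrightarrow> E i j"
      using difun f unfolding cls_def by blast
    finally show ?thesis by simp
  qed
  have "range \<alpha> = e ` range cls" by (auto simp: \<alpha>_def)
  also have "\<dots> = {..<card (range cls)}"
    using e by (auto simp: bij_betw_def)
  finally have ra: "range \<alpha> = {..<card (range cls)}" .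
  moreover have "range \<beta> = range \<alpha>"
  proof
    show "range \<beta> \<subseteq> range \<alpha>" by (auto simp: \<alpha>_def \<beta>_def)
    show "range \<alpha> \<subseteq> range \<beta>" using left iff by (metis image_subsetI rangeI)
  qed
  ultimately have "labelling (card (range cls)) \<alpha> \<beta>"
    by unfold_locales auto
  then show ?thesis using iff by blast
qed

section \<open>Maximal cells, and the order of the labels in each of them\<close>

lemma subdivision_in_maximal_cell:
  assumes "subdivision_of S P" "C \<in> S"
  shows "\<exists>D\<in>maximal_cells S. C \<subseteq> D"
proof -
  have "finite S" using assms by (simp add: subdivision_of_def)
  then obtain D where "D \<in> S" "C \<subseteq> D" "\<forall>D'\<in>S. D \<subseteq> D' \<longrightarrow> D' = D"
    using finite_has_maximal2[OF _ assms(2)] by metis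
  then show ?thesis by (auto simp: maximal_cells_def)
qed

lemma subdivision_eq_faces_of_maximal_cells:
  assumes S: "subdivision_of S P"
  shows "S = {F. \<exists>C\<in>maximal_cells S. F face_of C}"
proof (intro equalityI subsetI)
  fix F assume "F \<in> S"
  then obtain C where "C \<in> maximal_cells S" "F \<subseteq> C" using subdivision_in_maximal_cell[OF S] by blast
  then show "F \<in> {F. \<exists>C\<in>maximal_cells S. F face_of C}"
    using subdivision_subset_imp_face[OF S \<open>F \<in> S\<close>] by (auto simp: maximal_cells_def)
qed (use subdivision_face_in[OF S] in \<open>auto simp: maximal_cells_def\<close>)

lemma sum_single_of_bool:
  fixes c :: real and i :: "'e::finite"
  shows "(\<Sum>a\<in>UNIV. c * of_bool (a = i)) = c"
  by (simp add: of_bool_def if_distrib cong: if_cong)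

lemma sum_of_bool_eq_mult:
  fixes f :: "'e::finite \<Rightarrow> real"
  shows "(\<Sum>a\<in>UNIV. of_bool (a = i) * f a) = f i"
  by (simp add: of_bool_def if_distrib if_distribR cong: if_cong)

text \<open>Here the labels only number the pairs of parts cut out by the common cell
  \<open>H\<close>. Their cyclic order comes from the cells, as the permutation \<sigma> in
  \<open>eq_split\<close>.\<close>

locale centered_subdivision = labelling +
  fixes S :: "((real ^ 'a) \<times> (real ^ 'b)) set set" and H :: "((real ^ 'a) \<times> (real ^ 'b)) set"
  assumes S: "subdivision_of S simplex_product"
    and card_max: "card (maximal_cells S) = k"
    and H: "H \<in> S" and H_sub: "\<And>C. C \<in> maximal_cells S \<Longrightarrow> H \<subseteq> C"
    and H_iff: "\<And>i j. product_vertex i j \<in> H \<longleftrightarrow> \<alpha> i = \<beta> j"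
begin

lemma max_in [simp]: "C \<in> maximal_cells S \<Longrightarrow> C \<in> S"
  by (simp add: maximal_cells_def)

lemma covered_by_max:
  assumes "p \<in> simplex_product"
  shows "\<exists>C\<in>maximal_cells S. p \<in> C"
proof -
  have "p \<in> \<Union>S" using S assms by (simp add: subdivision_of_def)
  then show ?thesis using subdivision_in_maximal_cell[OF S] by blast
qed

lemma diagonal_in_max: "C \<in> maximal_cells S \<Longrightarrow> \<alpha> i = \<beta> j \<Longrightarrow> product_vertex i j \<in> C"
  using H_sub H_iff by blast

text \<open>The vertex \<open>ij'\<close> lies in some maximal cell, and so does \<open>i'j\<close>,
  because its labels agree; these two have the same midpoint as the two given vertices.\<close>

lemma max_swap:
  assumes C: "C \<in> maximal_cells S" "product_vertex i j \<in> C" "product_vertex i' j' \<in> C" "\<alpha> i' = \<beta> j"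
  shows "product_vertex i j' \<in> C"
proof -
  obtain D where D: "D \<in> maximal_cells S" "product_vertex i j' \<in> D"
    using covered_by_max[of "product_vertex i j'"] by auto
  show ?thesis
    using subdivision_swap(1)[OF S _ C(2,3) _ D(2)] C(1) D(1) diagonal_in_max[OF D(1) C(4)] by simp
qed

text \<open>The order on labels induced by a cell. For maximal cells \<open>arc_iff\<close> shows
  independence of the representatives \<open>i\<close> and \<open>j\<close>.\<close>

definition arc :: "((real ^ 'a) \<times> (real ^ 'b)) set \<Rightarrow> nat \<Rightarrow> nat \<Rightarrow> bool" where
  "arc C r s \<longleftrightarrow> (\<exists>i j. \<alpha> i = r \<and> \<beta> j = s \<and> product_vertex i j \<in> C)"

text \<open>Exchanges with vertices of equal labels replace first the row and then the column by
  others of the same label.\<close>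

lemma arc_iff:
  assumes C: "C \<in> maximal_cells S"
  shows "arc C (\<alpha> i) (\<beta> j) \<longleftrightarrow> product_vertex i j \<in> C"
proof
  assume "arc C (\<alpha> i) (\<beta> j)"
  then obtain i' j' where ij: "\<alpha> i' = \<alpha> i" "\<beta> j' = \<beta> j" "product_vertex i' j' \<in> C"
    by (auto simp: arc_def)
  obtain j0 where j0: "\<beta> j0 = \<alpha> i" using ex_\<beta>[of "\<alpha> i"] by auto
  obtain i0 where i0: "\<alpha> i0 = \<beta> j" using ex_\<alpha>[of "\<beta> j"] by auto
  have "product_vertex i j' \<in> C"
    using max_swap[OF C diagonal_in_max[OF C] ij(3), of i j0] ij j0 by simp
  then show "product_vertex i j \<in> C"
    using max_swap[OF C _ diagonal_in_max[OF C], of i j' i0 j] ij i0 by simp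
qed (auto simp: arc_def)

lemma arc_refl: "C \<in> maximal_cells S \<Longrightarrow> r < k \<Longrightarrow> arc C r r"
  unfolding arc_def using ex_\<alpha> ex_\<beta> diagonal_in_max by metis

lemma arc_trans:
  assumes C: "C \<in> maximal_cells S" and "arc C r s" "arc C s t"
  shows "arc C r t"
  using assms(2,3) max_swap[OF C] unfolding arc_def by metis

text \<open>Two vertices with opposite labels have the same midpoint as two vertices of
  \<open>H\<close>, so the exchange puts them into \<open>H\<close>, where labels agree.\<close>

lemma arc_antisym:
  assumes C: "C \<in> maximal_cells S" and "arc C r s" "arc C s r"
  shows "r = s"
proof -
  obtain i j i' j' where ij: "\<alpha> i = r" "\<beta> j = s" "product_vertex i j \<in> C"
    "\<alpha> i' = s" "\<beta> j' = r" "product_vertex i' j' \<in> C"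
    using assms(2,3) by (auto simp: arc_def)
  have "product_vertex i j \<in> H"
    using subdivision_swap(1)[OF S H, of i j' i' j C] C H_iff ij by simp
  then show ?thesis using H_iff ij by simp
qed

lemma max_lin_form_nonneg:
  assumes C: "C \<in> maximal_cells S" "p \<in> C"
    and "\<And>i j. product_vertex i j \<in> C \<Longrightarrow> 0 \<le> g i + h j"
  shows "0 \<le> lin_form g h p"
  using lin_form_nonneg_on_edge_hull[of p "\<lambda>i j. product_vertex i j \<in> C" g h]
    subdivision_cell_eq_edge_hull[OF S max_in[OF C(1)]] C(2) assms(3) by blast

text \<open>The test point has its x-mass on a single row and its y-mass spread over all columns; a
  cell around it must contain every vertex of that row.\<close>

lemma ex_source: 
  assumes "r < k"
  shows "\<exists>C\<in>maximal_cells S. \<forall>s<k. arc C r s"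
proof -
  obtain i where i: "\<alpha> i = r" using ex_\<alpha> assms by blast
  define p :: "(real ^ 'a) \<times> (real ^ 'b)" where "p = (axis i 1, \<chi> j. 1 / real CARD('b))"
  have "p \<in> simplex_product"
    by (simp add: p_def simplex_product_iff axis_def)
  then obtain C where C: "C \<in> maximal_cells S" "p \<in> C" using covered_by_max by blast
  have "product_vertex i j \<in> C" for j
  proof (rule ccontr)
    assume *: "product_vertex i j \<notin> C"
    \<comment> \<open>This form is negative at no vertex but \<open>ij\<close>, so it is nonnegative
      on a cell without that vertex.\<close>
    have "0 \<le> lin_form (\<lambda>a. of_bool (a \<noteq> i)) (\<lambda>b. - of_bool (b = j)) p"
      by (rule max_lin_form_nonneg[OF C]) (use * in auto)
    also have "\<dots> = - (1 / real CARD('b))"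
      by (simp add: lin_form_def p_def axis_def of_bool_def if_distrib if_distribR cong: if_cong)
    finally show False by simp
  qed
  then have "\<forall>s<k. arc C r s"
    using ex_\<beta> i unfolding arc_def by blast
  then show ?thesis using C by blast
qed

text \<open>By antisymmetry a cell has at most one least label, so the cells chosen for the
  \<open>k\<close> labels are distinct and exhaust the \<open>k\<close> maximal cells.\<close>

lemma ex_sources:
  "\<exists>c. bij_betw c {..<k} (maximal_cells S) \<and> (\<forall>r<k. \<forall>s<k. arc (c r) r s)"
proof -
  obtain c where c: "\<And>r. r < k \<Longrightarrow> c r \<in> maximal_cells S \<and> (\<forall>s<k. arc (c r) r s)"
    using ex_source by metis
  have inj: "inj_on c {..<k}"
  proof (rule inj_onI)
    fix r s assume "r \<in> {..<k}" "s \<in> {..<k}" "c r = c s"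
    then show "r = s" using c[of r] c[of s] arc_antisym[of "c r" r s] by auto
  qed
  moreover have "finite (maximal_cells S)"
    using card_max k_pos card_ge_0_finite by metis
  moreover have "c ` {..<k} \<subseteq> maximal_cells S" using c by auto
  ultimately have "c ` {..<k} = maximal_cells S"
    by (intro card_subset_eq) (auto simp: card_image card_max)
  then show ?thesis using c inj by (auto simp: bij_betw_def)
qed

text \<open>The test point puts half of its mass on each of two rows and three quarters on one column.\<close>

lemma ex_source_comparable:
  assumes c: "bij_betw c {..<k} (maximal_cells S)" "\<And>r s. r < k \<Longrightarrow> s < k \<Longrightarrow> arc (c r) r s"
    and rs: "r < k" "r' < k" "s < k" "distinct [r, r', s]"
  shows "arc (c r) r' s \<or> arc (c r') r s"
proof -
  obtain i i' j where ij: "\<alpha> i = r" "\<alpha> i' = r'" "\<beta> j = s"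
    using ex_\<alpha> ex_\<beta> rs by metis
  have neq: "i \<noteq> i'" using ij rs by auto
  let ?l = "real CARD('b)"
  \<comment> \<open>The remaining quarter is spread evenly, which gives every column positive
    mass.\<close>
  define y :: "real ^ 'b" where "y = (\<chi> b. 3/4 * of_bool (b = j) + 1 / (4 * ?l))"
  define p where "p = ((1/2) *\<^sub>R axis i 1 + (1/2) *\<^sub>R axis i' 1 :: real ^ 'a, y)"
  have x: "fst p $ a = 1/2 * of_bool (a = i) + 1/2 * of_bool (a = i')" for a
    by (auto simp: p_def axis_def)
  have y: "snd p $ b = 3/4 * of_bool (b = j) + 1 / (4 * ?l)" for b
    by (simp add: p_def y_def)
  have "(\<Sum>a\<in>UNIV. fst p $ a) = 1" "(\<Sum>b\<in>UNIV. snd p $ b) = 1"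
    unfolding x y sum.distrib sum_single_of_bool by simp_all
  then have "p \<in> simplex_product"
    unfolding simplex_product_iff by (simp add: x y)
  then obtain C where C: "C \<in> maximal_cells S" "p \<in> C" using covered_by_max by blast
  then obtain q where q: "q < k" "C = c q"
    using c(1) by (auto simp: bij_betw_def)
  \<comment> \<open>Without such an arc, row \<open>a\<close> with mass 1/2 could only be matched to
    columns of labels other than \<open>s\<close>, whose total mass is at most 1/4.\<close>
  have to_s: "arc C (\<alpha> a) s" if a: "a = i \<or> a = i'" for a
  proof (rule ccontr)
    assume *: "\<not> arc C (\<alpha> a) s"
    have "0 \<le> lin_form (\<lambda>a'. - of_bool (a' = a)) (\<lambda>b. of_bool (\<beta> b \<noteq> s)) p"
      by (rule max_lin_form_nonneg[OF C]) (use * arc_iff[OF C(1)] in auto)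
    also have "\<dots> = - 1/2 + (\<Sum>b\<in>UNIV. of_bool (\<beta> b \<noteq> s) * snd p $ b)"
      using a neq by (auto simp: lin_form_def sum_negf sum_of_bool_eq_mult x)
    also have "(\<Sum>b\<in>UNIV. of_bool (\<beta> b \<noteq> s) * snd p $ b) \<le> of_nat (card (UNIV :: 'b set)) * (1 / (4 * ?l))"
      by (rule sum_bounded_above) (use ij in \<open>auto simp: y\<close>)
    finally show False by simp
  qed
  \<comment> \<open>If another label \<open>q\<close> were the source, no arc of \<open>C\<close>
    would lead from \<open>r\<close> or \<open>r'\<close> back to \<open>q\<close>, and the mass on
    a column of label \<open>q\<close> could not be matched.\<close>
  have "q = r \<or> q = r'"
  proof (rule ccontr)
    assume *: "\<not> (q = r \<or> q = r')"
    obtain b where b: "\<beta> b = q" using ex_\<beta> q by blast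
    have "\<not> arc C r q" "\<not> arc C r' q"
      using arc_antisym[OF C(1)] c(2)[of q r] c(2)[of q r'] * q rs by auto
    then have no: "product_vertex i b \<notin> C" "product_vertex i' b \<notin> C"
      using arc_iff[OF C(1)] ij b by metis+
    have "0 \<le> lin_form (\<lambda>a. of_bool (a \<noteq> i \<and> a \<noteq> i')) (\<lambda>b'. - of_bool (b' = b)) p"
      by (rule max_lin_form_nonneg[OF C]) (use no in auto)
    also have "\<dots> = - snd p $ b"
    proof -
      have "(\<Sum>a\<in>UNIV. of_bool (a \<noteq> i \<and> a \<noteq> i') * fst p $ a) = 0"
        by (rule sum.neutral) (auto simp: x)
      then show ?thesis
        by (simp add: lin_form_def sum_negf sum_of_bool_eq_mult)
    qed
    finally have "snd p $ b \<le> 0" by simp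
    moreover have "0 < snd p $ b"
      unfolding y by (intro add_nonneg_pos) simp_all
    ultimately show False by simp
  qed
  then show ?thesis using to_s[of i] to_s[of i'] ij q by auto
qed

text \<open>The two relations give two pairs of vertices with a common midpoint in different cells.
  The exchange puts \<open>r\<close> before \<open>r'\<close> in the cell whose source is
  \<open>r'\<close>.\<close>

lemma source_incomparable:
  assumes c: "bij_betw c {..<k} (maximal_cells S)" "\<And>r s. r < k \<Longrightarrow> s < k \<Longrightarrow> arc (c r) r s"
    and rs: "r < k" "r' < k" "s < k" "distinct [r, r', s]"
  shows "\<not> (arc (c r) r' s \<and> arc (c r') r s)"
proof
  assume *: "arc (c r) r' s \<and> arc (c r') r s"
  obtain i i' j j' where ij: "\<alpha> i = r" "\<alpha> i' = r'" "\<beta> j = s" "\<beta> j' = r'"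
    using ex_\<alpha> ex_\<beta> rs by metis
  have max: "c r \<in> maximal_cells S" "c r' \<in> maximal_cells S"
    using c(1) rs by (auto simp: bij_betw_def)
  have "product_vertex i j' \<in> c r'"
  proof (rule subdivision_swap(1)[OF S])
    show "product_vertex i j \<in> c r'" "product_vertex i' j' \<in> c r'"
      using * ij arc_iff[OF max(2)] diagonal_in_max[OF max(2)] by auto
    show "product_vertex i j' \<in> c r" "product_vertex i' j \<in> c r"
      using * ij arc_iff[OF max(1)] c(2) rs by metis+
  qed (use max in auto)
  then have "arc (c r') r r'" using ij arc_iff[OF max(2)] by metis
  then show False
    using arc_antisym[OF max(2)] c(2)[of r' r] rs by auto
qed

text \<open>The orders of the cells, indexed by their sources, form a cyclic order. After
  relabelling by the positions, the cell with source \<open>r\<close> has the vertices of a split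
  cell.\<close>

lemma eq_split: "\<exists>\<alpha>' \<beta>'. labelling k \<alpha>' \<beta>' \<and> S = split_of k \<alpha>' \<beta>'"
proof -
  obtain c where c: "bij_betw c {..<k} (maximal_cells S)" "\<And>r s. r < k \<Longrightarrow> s < k \<Longrightarrow> arc (c r) r s"
    using ex_sources by blast
  have max: "c r \<in> maximal_cells S" if "r < k" for r
    using c(1) that by (auto simp: bij_betw_def)
  have "\<exists>\<sigma>. bij_betw \<sigma> {..<k} {..<k} \<and>
    (\<forall>r<k. \<forall>a<k. \<forall>b<k. arc (c r) a b \<longleftrightarrow> cyc_le k (\<sigma> r) (\<sigma> a) (\<sigma> b))"
  proof (rule cyclic_order_positions)
    show "arc (c r) a b \<noteq> arc (c a) r b" if "r < k" "a < k" "b < k" "distinct [r, a, b]" for r a b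
      using ex_source_comparable[OF c that] source_incomparable[OF c that] by blast
  qed (use max arc_refl arc_trans arc_antisym c(2) in blast)+
  then obtain \<sigma> where \<sigma>: "bij_betw \<sigma> {..<k} {..<k}"
    "\<And>r a b. r < k \<Longrightarrow> a < k \<Longrightarrow> b < k \<Longrightarrow> arc (c r) a b \<longleftrightarrow> cyc_le k (\<sigma> r) (\<sigma> a) (\<sigma> b)"
    by blast
  have cell: "c r = split_cell k (\<sigma> \<circ> \<alpha>) (\<sigma> \<circ> \<beta>) (\<sigma> r)" if r: "r < k" for r
  proof -
    have "c r = edge_hull (\<lambda>i j. product_vertex i j \<in> c r)"
      by (rule subdivision_cell_eq_edge_hull[OF S]) (use max r in simp)
    then show ?thesis
      using \<sigma>(2)[OF r] arc_iff[OF max[OF r]] by (simp add: split_cell_def)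
  qed
  have "range (\<sigma> \<circ> \<alpha>) = {..<k}" "range (\<sigma> \<circ> \<beta>) = {..<k}"
    using \<sigma>(1) unfolding image_comp[symmetric] range_\<alpha> range_\<beta> by (simp_all add: bij_betw_def)
  then have "labelling k (\<sigma> \<circ> \<alpha>) (\<sigma> \<circ> \<beta>)" by unfold_locales
  moreover have "maximal_cells S = split_cell k (\<sigma> \<circ> \<alpha>) (\<sigma> \<circ> \<beta>) ` {..<k}"
  proof -
    have "maximal_cells S = c ` {..<k}" using c(1) by (simp add: bij_betw_def)
    also have "\<dots> = split_cell k (\<sigma> \<circ> \<alpha>) (\<sigma> \<circ> \<beta>) ` \<sigma> ` {..<k}"
      using cell by (simp add: image_image)
    finally show ?thesis using \<sigma>(1) by (simp add: bij_betw_def)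
  qed
  then have "S = split_of k (\<sigma> \<circ> \<alpha>) (\<sigma> \<circ> \<beta>)"
    using subdivision_eq_faces_of_maximal_cells[OF S] by (auto simp: split_of_def)
  ultimately show ?thesis by blast
qed

end

text \<open>An index that occurs in no edge makes its coordinate vanish on the hull, which inner
  points exclude.\<close>

lemma inner_edge_hull_covers:
  assumes H: "H = edge_hull E" and p: "p \<in> H" "p \<in> rel_interior simplex_product"
  shows "\<exists>j. E i j" "\<exists>i. E i j"
proof -
  show "\<exists>j. E i j"
  proof (rule ccontr)
    assume *: "\<nexists>j. E i j"
    have "0 \<le> lin_form (\<lambda>i'. - of_bool (i' = i)) (\<lambda>_. 0) p"
      by (rule lin_form_nonneg_on_edge_hull[of _ E]) (use H p * in auto)
    also have "\<dots> = - fst p $ i"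
      by (simp add: lin_form_def sum_negf sum_of_bool_eq_mult)
    finally show False using rel_interior_simplex_product_pos(1)[OF p(2), of i] by simp
  qed
  show "\<exists>i. E i j"
  proof (rule ccontr)
    assume *: "\<nexists>i. E i j"
    have "0 \<le> lin_form (\<lambda>_. 0) (\<lambda>j'. - of_bool (j' = j)) p"
      by (rule lin_form_nonneg_on_edge_hull[of _ E]) (use H p * in auto)
    also have "\<dots> = - snd p $ j"
      by (simp add: lin_form_def sum_negf sum_of_bool_eq_mult)
    finally show False using rel_interior_simplex_product_pos(2)[OF p(2), of j] by simp
  qed
qed

lemma k_split_imp_split:
  assumes "k_split k S (simplex_product :: ((real ^ 'd) \<times> (real ^ 'l)) set)"
  shows "\<exists>\<alpha> \<beta>. labelling k \<alpha> \<beta> \<and> S = split_of k \<alpha> \<beta>"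
proof -
  have S: "subdivision_of S simplex_product" and card: "card (maximal_cells S) = k"
    using assms by (auto simp: k_split_def coarsest_subdivision_def)
  obtain H where H: "H \<in> S" "\<And>C. C \<in> maximal_cells S \<Longrightarrow> H \<subseteq> C"
    "H \<inter> rel_interior simplex_product \<noteq> {}"
    "aff_dim H = aff_dim (simplex_product :: ((real ^ 'd) \<times> (real ^ 'l)) set) - (int k - 1)"
    using assms by (auto simp: k_split_def)
  have hull: "H = edge_hull (\<lambda>i j. product_vertex i j \<in> H)"
    by (rule subdivision_cell_eq_edge_hull[OF S H(1)])
  \<comment> \<open>The affine hull is used because it is closed under the parallelogram relation,
    which makes \<open>E\<close> difunctional.\<close>
  define E where "E i j \<longleftrightarrow> product_vertex i j \<in> affine hull H" for i j
  have HE: "product_vertex i j \<in> H \<Longrightarrow> E i j" for i j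
    by (simp add: E_def hull_inc)
  have "\<exists>m \<alpha> \<beta>. labelling m \<alpha> \<beta> \<and> (\<forall>i j. E i j \<longleftrightarrow> \<alpha> i = \<beta> j)"
  proof (rule difunctional_labelling)
    show "\<exists>j. E i j" "\<exists>i. E i j" for i j
      using inner_edge_hull_covers[OF hull] H(3) HE by blast+
    show "E i j'" if "E i j" "E i' j" "E i' j'" for i j i' j'
    proof -
      have "product_vertex i j + 1 *\<^sub>R (product_vertex i' j' - product_vertex i' j) \<in> affine hull H"
        using that by (intro mem_affine_3_minus) (auto simp: E_def)
      then show ?thesis
        using product_vertex_parallelogram[of i j i' j'] by (simp add: E_def algebra_simps)
    qed
  qed
  then obtain m \<alpha> \<beta> where lab: "labelling m \<alpha> \<beta>" and E_iff: "\<And>i j. E i j \<longleftrightarrow> \<alpha> i = \<beta> j"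
    by blast
  interpret labelling m \<alpha> \<beta> by (rule lab)
  have zero: "dominance_form \<alpha> \<beta> q p = 0" if "p \<in> H" for p q
  proof -
    have "edge_hull (\<lambda>i j. product_vertex i j \<in> H) \<subseteq> dominance_form \<alpha> \<beta> q -` {0}"
      by (intro edge_hull_subset convex_linear_vimage linear_dominance_form)
         (use HE E_iff in \<open>auto simp: dominance_form_product_vertex\<close>)
    then show ?thesis using that hull by auto
  qed
  \<comment> \<open>The codimension of \<open>H\<close> is one less than the number of
    labels.\<close>
  have "aff_dim (simplex_product :: ((real ^ 'd) \<times> (real ^ 'l)) set) = aff_dim H + (int m - 1)"
    by (rule aff_dim_simplex_product) (use zero subdivision_cellD(4)[OF S H(1)] E_iff E_def in auto)
  then have mk: "m = k" using H(4) by simp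
  \<comment> \<open>Passes from the affine hull back to \<open>H\<close>: a face of a cell is the
    intersection of the cell with its own affine hull.\<close>
  have H_iff: "product_vertex i j \<in> H \<longleftrightarrow> \<alpha> i = \<beta> j" for i j
  proof
    assume "\<alpha> i = \<beta> j"
    then have aff: "product_vertex i j \<in> affine hull H" using E_iff E_def by blast
    have "product_vertex i j \<in> \<Union>S"
      using S by (simp add: subdivision_of_def)
    then obtain C where C: "C \<in> maximal_cells S" "product_vertex i j \<in> C"
      using subdivision_in_maximal_cell[OF S] by blast
    then have "C \<in> S" by (simp add: maximal_cells_def)
    then have "H face_of C"
      using subdivision_subset_imp_face[OF S H(1)] H(2)[OF C(1)] by blast
    then have "H = affine hull H \<inter> C"
      using face_of_imp_eq_affine_Int subdivision_cellD(2)[OF S \<open>C \<in> S\<close>] by blast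
    then show "product_vertex i j \<in> H" using aff C(2) by blast
  qed (use HE E_iff in blast)
  have "centered_subdivision k \<alpha> \<beta> S H"
    using lab S card H(1,2) H_iff unfolding mk centered_subdivision_def centered_subdivision_axioms_def
    by blast
  then show ?thesis
    using centered_subdivision.eq_split by blast
qed


section \<open>Counting ordered partitions\<close>

definition ordered_partitions :: "'a set \<Rightarrow> nat \<Rightarrow> 'a set list set" where
  "ordered_partitions V k = {As. length As = k \<and> distinct As \<and> partition_on V (set As)}"

text \<open>The number of surjections from \<open>n\<close> elements onto \<open>k\<close>, that is
  k! times a Stirling number of the second kind; the recursion chooses the first fibre.\<close>

primrec ordered_partition_count :: "nat \<Rightarrow> nat \<Rightarrow> nat" where
  "ordered_partition_count 0 n = of_bool (n = 0)"
| "ordered_partition_count (Suc k) n = (\<Sum>a = 1..n. (n choose a) * ordered_partition_count k (n - a))"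

lemma finite_ordered_partitions: "finite V \<Longrightarrow> finite (ordered_partitions V k)"
proof (rule finite_subset)
  show "ordered_partitions V k \<subseteq> {As. set As \<subseteq> Pow V \<and> length As = k}"
    by (auto simp: ordered_partitions_def partition_on_def)
qed (simp add: finite_lists_length_eq)

lemma ordered_partitions_Suc:
  "ordered_partitions V (Suc k) = (\<Union>A\<in>Pow V - {{}}. (#) A ` ordered_partitions (V - A) k)"
proof -
  have "A # As \<in> ordered_partitions V (Suc k) \<longleftrightarrow>
      A \<in> Pow V - {{}} \<and> As \<in> ordered_partitions (V - A) k" for A As
  proof -
    have "partition_on V (insert A (set As)) \<and> A \<notin> set As \<longleftrightarrow>
        A \<subseteq> V \<and> A \<noteq> {} \<and> partition_on (V - A) (set As)"
    proof (cases "disjnt A (\<Union>(set As))")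
      case True
      then have "A \<noteq> {} \<Longrightarrow> A \<notin> set As" by (auto simp: disjnt_def)
      then show ?thesis using partition_on_insert[OF True, of V] by auto
    next
      case False
      then have "\<not> partition_on (V - A) (set As)"
        by (auto simp: partition_on_def disjnt_def)
      moreover have "\<not> (partition_on V (insert A (set As)) \<and> A \<notin> set As)"
        using False by (fastforce simp: partition_on_def disjoint_def disjnt_def)
      ultimately show ?thesis by blast
    qed
    then show ?thesis by (auto simp: ordered_partitions_def)
  qed
  then have "As \<in> ordered_partitions V (Suc k) \<longleftrightarrow>
      As \<in> (\<Union>A\<in>Pow V - {{}}. (#) A ` ordered_partitions (V - A) k)" for As
    by (cases As) (auto simp: ordered_partitions_def)
  then show ?thesis by blast
qed

lemma card_ordered_partitions:
  "finite V \<Longrightarrow> card (ordered_partitions V k) = ordered_partition_count k (card V)"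
proof (induction k arbitrary: V)
  case 0
  have "ordered_partitions V 0 = (if V = {} then {[]} else {})"
    by (auto simp: ordered_partitions_def partition_on_def)
  then show ?case using 0 by simp
next
  case (Suc k)
  let ?N = "\<lambda>a. ordered_partition_count k (card V - a)"
  have "card (ordered_partitions V (Suc k)) = (\<Sum>A\<in>Pow V - {{}}. card ((#) A ` ordered_partitions (V - A) k))"
    unfolding ordered_partitions_Suc
    by (rule card_UN_disjoint) (use Suc.prems in \<open>auto simp: finite_ordered_partitions\<close>)
  also have "\<dots> = (\<Sum>A\<in>Pow V - {{}}. ?N (card A))"
  proof (rule sum.cong)
    fix A assume "A \<in> Pow V - {{}}"
    then have "finite (V - A)" "card (V - A) = card V - card A"
      using Suc.prems by (auto simp: card_Diff_subset finite_subset)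
    then show "card ((#) A ` ordered_partitions (V - A) k) = ?N (card A)"
      using Suc.IH by (simp add: card_image)
  qed simp
  also have "\<dots> = (\<Sum>a = 1..card V. \<Sum>A\<in>{A \<in> Pow V - {{}}. card A = a}. ?N (card A))"
  proof (rule sum.group[symmetric])
    show "card ` (Pow V - {{}}) \<subseteq> {1..card V}"
      using Suc.prems by (auto simp: Suc_le_eq card_gt_0_iff card_mono finite_subset)
  qed (use Suc.prems in auto)
  also have "\<dots> = (\<Sum>a = 1..card V. (card V choose a) * ?N a)"
  proof (rule sum.cong)
    fix a assume "a \<in> {1..card V}"
    then have "{A \<in> Pow V - {{}}. card A = a} = {A. A \<subseteq> V \<and> card A = a}" by auto
    then show "(\<Sum>A\<in>{A \<in> Pow V - {{}}. card A = a}. ?N (card A)) = (card V choose a) * ?N a"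
      using n_subsets[OF Suc.prems, of a] by simp
  qed simp
  finally show ?case by simp
qed

text \<open>The vanishing terms bridge the gap between the ranges \<open>{1..n}\<close> of the
  recursion and \<open>{1..n - k}\<close> of the iterated sum.\<close>

lemma ordered_partition_count_eq_0: "n < k \<Longrightarrow> ordered_partition_count k n = 0"
  by (induction k arbitrary: n) auto

lemma finite_sum_indices: "finite (sum_indices n k)"
proof (rule finite_subset)
  show "sum_indices n k \<subseteq> {1..k-1} \<rightarrow>\<^sub>E {..n}"
    by (force simp: sum_indices_def remaining_def PiE_iff)
qed (simp add: finite_PiE)

lemma remaining_Suc: "1 \<le> j \<Longrightarrow> remaining n a (Suc j) = remaining (n - a 1) (\<lambda>i. a (Suc i)) j"
proof -
  assume j: "1 \<le> j"
  have "(\<Sum>i = 1..<Suc j. a i) = a 1 + (\<Sum>i = Suc 1..<Suc j. a i)"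
    using j by (subst sum.atLeast_Suc_lessThan) auto
  also have "(\<Sum>i = Suc 1..<Suc j. a i) = (\<Sum>i = 1..<j. a (Suc i))"
    by (rule sum.shift_bounds_Suc_ivl)
  finally show ?thesis by (simp add: remaining_def)
qed

lemma remaining_cong: "(\<And>i. 1 \<le> i \<Longrightarrow> i < j \<Longrightarrow> a i = b i) \<Longrightarrow> remaining n a j = remaining n b j"
  by (simp add: remaining_def)

text \<open>Once the first index is fixed at \<open>c\<close>, the others form an index tuple of the
  same kind for \<open>n - c\<close>, shifted by one place.\<close>

lemma iterated_binomial_sum_Suc:
  assumes k: "1 \<le> k"
  shows "iterated_binomial_sum n (Suc k)
    = (\<Sum>c = 1..n - k. (n choose c) * iterated_binomial_sum (n - c) k)"
proof -
  \<comment> \<open>\<open>f\<close> splits off the first entry and shifts the rest,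
    \<open>g\<close> undoes this; the restrictions keep the tuples extensional, so that the maps are
    inverse to each other.\<close>
  define f where "f a = (a 1, restrict (\<lambda>j. a (Suc j)) {1..k-1})" for a :: "nat \<Rightarrow> nat"
  define g where "g cb = restrict (\<lambda>j. if j = 1 then fst cb else snd cb (j - 1)) {1..k}"
    for cb :: "nat \<times> (nat \<Rightarrow> nat)"
  define summand where "summand m k a = (\<Prod>j = 1..k-1. remaining m a j choose a j)" for m k a
  have ind: "Ball {1..k} Q \<longleftrightarrow> Q 1 \<and> (\<forall>j\<in>{1..k-1}. Q (Suc j))" for Q
  proof -
    have "{1..k} = insert 1 (Suc ` {1..k-1})"
      using k by (auto simp: image_iff)
    then show ?thesis by (simp only: ball_simps)
  qed
  have rem1: "remaining n a 1 = n" for a by (simp add: remaining_def)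
  have rem: "remaining n a (Suc j) = remaining (n - fst (f a)) (snd (f a)) j"
    if "j \<in> {1..k-1}" for a j
    unfolding remaining_Suc[of j n a] f_def fst_conv snd_conv using that
    by (subst remaining_Suc) (auto intro!: remaining_cong)
  have mem: "a \<in> sum_indices n (Suc k) \<longleftrightarrow>
      a \<in> extensional {1..k} \<and> fst (f a) \<in> {1..n - k} \<and> snd (f a) \<in> sum_indices (n - fst (f a)) k" for a
  proof -
    have "a \<in> sum_indices n (Suc k) \<longleftrightarrow> a \<in> extensional {1..k} \<and>
        (\<forall>j\<in>{1..k}. a j \<in> {1..remaining n a j - (Suc k - j)})"
      by (auto simp: sum_indices_def PiE_iff)
    also have "\<dots> \<longleftrightarrow> a \<in> extensional {1..k} \<and> a 1 \<in> {1..n - k} \<and>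
        (\<forall>j\<in>{1..k-1}. a (Suc j) \<in> {1..remaining n a (Suc j) - (k - j)})"
      unfolding ind rem1 by simp
    also have "\<dots> \<longleftrightarrow> a \<in> extensional {1..k} \<and> fst (f a) \<in> {1..n - k} \<and>
        (\<forall>j\<in>{1..k-1}. snd (f a) j \<in> {1..remaining (n - fst (f a)) (snd (f a)) j - (k - j)})"
      using rem by (simp add: f_def)
    also have "\<dots> \<longleftrightarrow>
      a \<in> extensional {1..k} \<and> fst (f a) \<in> {1..n - k} \<and> snd (f a) \<in> sum_indices (n - fst (f a)) k"
      by (auto simp: sum_indices_def PiE_iff f_def)
    finally show ?thesis .
  qed
  have gf: "g (f a) = a" if "a \<in> extensional {1..k}" for a
    using that by (intro ext) (auto simp: g_def f_def extensional_def restrict_def)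
  have fg: "f (g cb) = cb" if "snd cb \<in> extensional {1..k-1}" for cb
    using that k by (intro prod_eqI ext) (auto simp: g_def f_def extensional_def restrict_def)
  have "iterated_binomial_sum n (Suc k) = (\<Sum>a\<in>sum_indices n (Suc k). summand n (Suc k) a)"
    by (simp add: iterated_binomial_sum_def summand_def)
  also have "\<dots> = (\<Sum>(c, b)\<in>(SIGMA c:{1..n - k}. sum_indices (n - c) k). (n choose c) * summand (n - c) k b)"
  proof (rule sum.reindex_bij_witness[of _ g f])
    fix a assume a: "a \<in> sum_indices n (Suc k)"
    then show "g (f a) = a" using mem gf by blast
    show "f a \<in> (SIGMA c:{1..n - k}. sum_indices (n - c) k)"
      using a mem by (simp add: mem_Sigma_iff[of "fst (f a)" "snd (f a)", simplified])
    have "summand n (Suc k) a = (\<Prod>j\<in>{1..k}. remaining n a j choose a j)"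
      by (simp add: summand_def)
    also have "{1..k} = insert 1 {Suc 1..k}" using k by auto
    also have "(\<Prod>j\<in>insert 1 {Suc 1..k}. remaining n a j choose a j)
        = (n choose a 1) * (\<Prod>j = Suc 1..Suc (k - 1). remaining n a j choose a j)"
      using k by (simp add: rem1 del: One_nat_def)
    also have "(\<Prod>j = Suc 1..Suc (k - 1). remaining n a j choose a j)
        = (\<Prod>j = 1..k-1. remaining n a (Suc j) choose a (Suc j))"
      by (rule prod.shift_bounds_cl_Suc_ivl)
    also have "\<dots> = summand (n - fst (f a)) k (snd (f a))"
      unfolding summand_def by (rule prod.cong) (use rem in \<open>simp_all add: f_def\<close>)
    finally show "(case f a of (c, b) \<Rightarrow> (n choose c) * summand (n - c) k b) = summand n (Suc k) a"
      by (simp add: f_def)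
  next
    fix cb assume cb: "cb \<in> (SIGMA c:{1..n - k}. sum_indices (n - c) k)"
    then have "snd cb \<in> extensional {1..k-1}"
      by (auto simp: sum_indices_def PiE_iff)
    then show fgcb: "f (g cb) = cb" by (rule fg)
    have "g cb \<in> extensional {1..k}" by (simp add: g_def)
    then show "g cb \<in> sum_indices n (Suc k)"
      using cb mem[of "g cb"] fgcb by (auto simp: mem_Sigma_iff)
  qed
  also have "\<dots> = (\<Sum>c = 1..n - k. \<Sum>b\<in>sum_indices (n - c) k. (n choose c) * summand (n - c) k b)"
    by (rule sum.Sigma[symmetric]) (auto simp: finite_sum_indices)
  also have "\<dots> = (\<Sum>c = 1..n - k. (n choose c) * iterated_binomial_sum (n - c) k)"
    by (simp add: iterated_binomial_sum_def summand_def sum_distrib_left)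
  finally show ?thesis .
qed

lemma iterated_binomial_sum_eq_count:
  assumes "1 \<le> k" "1 \<le> n"
  shows "iterated_binomial_sum n k = ordered_partition_count k n"
  using assms
proof (induction k arbitrary: n rule: nat_induct_at_least)
  case base
  \<comment> \<open>For \<open>k = 1\<close> there is no index, so the sum has one term, an empty
    product.\<close>
  have "sum_indices n 1 = {\<lambda>_. undefined}"
    by (auto simp: sum_indices_def)
  then have "iterated_binomial_sum n 1 = 1"
    by (simp add: iterated_binomial_sum_def)
  \<comment> \<open>Only \<open>a = n\<close> survives, since a partition without parts needs the
    empty set.\<close>
  moreover have "ordered_partition_count 1 n = (\<Sum>a\<in>{n}. n choose a)"
    unfolding One_nat_def ordered_partition_count.simps
    by (rule sum.mono_neutral_cong_right) (use base in auto)
  ultimately show ?case by simp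
next
  case (Suc k)
  have "iterated_binomial_sum n (Suc k) = (\<Sum>c = 1..n - k. (n choose c) * ordered_partition_count k (n - c))"
    unfolding iterated_binomial_sum_Suc[OF Suc.hyps(1)]
    using Suc.hyps(1) by (intro sum.cong) (auto simp: Suc.IH)
  also have "\<dots> = (\<Sum>c = 1..n. (n choose c) * ordered_partition_count k (n - c))"
    by (rule sum.mono_neutral_left) (auto simp: ordered_partition_count_eq_0)
  finally show ?case by simp
qed


section \<open>Pair lists, labellings and rotations\<close>

lemma pair_lists_eq:
  "pair_lists k = {xs. map fst xs \<in> ordered_partitions UNIV k \<and> map snd xs \<in> ordered_partitions UNIV k}"
  by (auto simp: pair_lists_def is_partition_def ordered_partitions_def)

lemma card_pair_lists:
  "card (pair_lists k :: ('d::finite set \<times> 'l::finite set) list set)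
    = ordered_partition_count k CARD('d) * ordered_partition_count k CARD('l)"
  and finite_pair_lists: "finite (pair_lists k :: ('d::finite set \<times> 'l::finite set) list set)"
proof -
  let ?f = "\<lambda>xs :: ('d set \<times> 'l set) list. (map fst xs, map snd xs)"
  have inj: "inj_on ?f (pair_lists k)"
    by (rule inj_onI) (simp add: pair_list_eqI)
  have im: "?f ` pair_lists k = ordered_partitions UNIV k \<times> ordered_partitions UNIV k"
  proof (intro equalityI subsetI)
    fix p :: "'d set list \<times> 'l set list"
    assume "p \<in> ordered_partitions UNIV k \<times> ordered_partitions UNIV k"
    then have "zip (fst p) (snd p) \<in> pair_lists k \<and> p = ?f (zip (fst p) (snd p))"
      by (auto simp: pair_lists_eq ordered_partitions_def simp del: set_map)
    then show "p \<in> ?f ` pair_lists k" by blast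
  qed (auto simp: pair_lists_eq)
  show "finite (pair_lists k :: ('d set \<times> 'l set) list set)"
    using finite_imageD[OF _ inj] by (simp add: im finite_ordered_partitions)
  have "card (pair_lists k :: ('d set \<times> 'l set) list set) = card (?f ` pair_lists k)"
    by (rule card_image[OF inj, symmetric])
  then show "card (pair_lists k :: ('d set \<times> 'l set) list set)
      = ordered_partition_count k CARD('d) * ordered_partition_count k CARD('l)"
    by (simp add: im card_cartesian_product card_ordered_partitions)
qed

definition fibre_list :: "nat \<Rightarrow> ('a \<Rightarrow> nat) \<Rightarrow> 'a set list" where
  "fibre_list k \<alpha> = map (\<lambda>r. \<alpha> -` {r}) [0..<k]"

lemma fibre_list_inj:
  assumes "range \<alpha> = {..<k}" "fibre_list k \<alpha> = fibre_list k \<alpha>'"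
  shows "\<alpha> = \<alpha>'"
proof
  fix i
  have "\<alpha> i < k" using assms(1) by blast
  then have "\<alpha> -` {\<alpha> i} = \<alpha>' -` {\<alpha> i}"
    using assms(2) by (auto simp: fibre_list_def map_eq_conv)
  moreover have "i \<in> \<alpha> -` {\<alpha> i}" by simp
  ultimately have "i \<in> \<alpha>' -` {\<alpha> i}" by blast
  then show "\<alpha> i = \<alpha>' i" by simp
qed

lemma ordered_partitions_UNIV: "ordered_partitions UNIV k = fibre_list k ` {\<alpha>. range \<alpha> = {..<k}}"
proof (intro equalityI subsetI)
  fix As :: "'a set list"
  assume "As \<in> ordered_partitions UNIV k"
  then have As: "length As = k" "distinct As" "partition_on UNIV (set As)"
    by (auto simp: ordered_partitions_def)
  have uniq: "r = s" if "r < k" "s < k" "i \<in> As ! r" "i \<in> As ! s" for r s i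
  proof -
    have "As ! r = As ! s"
      using As that partition_onD2[OF As(3)] unfolding disjoint_def by (metis disjoint_iff nth_mem)
    then show ?thesis using As that by (simp add: nth_eq_iff_index_eq)
  qed
  have "\<exists>r<k. i \<in> As ! r" for i
  proof -
    have "i \<in> \<Union>(set As)" using partition_onD1[OF As(3)] by simp
    then show ?thesis using As(1) by (auto simp: in_set_conv_nth)
  qed
  then obtain \<alpha> where \<alpha>: "\<And>i. \<alpha> i < k \<and> i \<in> As ! \<alpha> i" by metis
  have fib: "\<alpha> -` {r} = As ! r" if "r < k" for r
    using \<alpha> uniq[OF _ that] by auto
  have "{..<k} \<subseteq> range \<alpha>"
  proof
    fix r assume "r \<in> {..<k}"
    then have "As ! r \<noteq> {}"
      using partition_onD3[OF As(3)] As(1) by (metis lessThan_iff nth_mem)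
    then show "r \<in> range \<alpha>" using fib[of r] \<open>r \<in> _\<close> by auto
  qed
  then have "range \<alpha> = {..<k}" using \<alpha> by auto
  moreover have "As = fibre_list k \<alpha>"
    using As(1) fib by (auto simp: fibre_list_def intro: nth_equalityI)
  ultimately show "As \<in> fibre_list k ` {\<alpha>. range \<alpha> = {..<k}}" by blast
next
  fix As :: "'a set list"
  assume "As \<in> fibre_list k ` {\<alpha>. range \<alpha> = {..<k}}"
  then obtain \<alpha> where \<alpha>: "range \<alpha> = {..<k}" "As = fibre_list k \<alpha>" by blast
  have ne: "\<alpha> -` {r} \<noteq> {}" if "r < k" for r
    using \<alpha>(1) that by (metis imageE lessThan_iff vimage_singleton_eq empty_iff)
  have "inj_on (\<lambda>r. \<alpha> -` {r}) {0..<k}"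
    using ne by (intro inj_onI) fastforce
  moreover have "partition_on UNIV (set As)"
  proof (rule partition_onI)
    show "\<Union>(set As) = UNIV"
      using \<alpha>(1) by (auto simp: \<alpha>(2) fibre_list_def)
    show "{} \<notin> set As"
      using ne by (fastforce simp: \<alpha>(2) fibre_list_def)
  qed (auto simp: \<alpha>(2) fibre_list_def disjnt_def)
  ultimately show "As \<in> ordered_partitions UNIV k"
    by (simp add: ordered_partitions_def \<alpha>(2) fibre_list_def distinct_map)
qed

text \<open>Adding \<open>n\<close> to the labels moves each part \<open>n\<close> places towards
  the end, whereas \<open>rotate\<close> moves entries towards the front; hence the complementary
  amount.\<close>

lemma rotate_fibre_list:
  assumes "range \<alpha> = {..<k}"
  shows "fibre_list k (\<lambda>i. (\<alpha> i + n) mod k) = rotate (k - n mod k) (fibre_list k \<alpha>)"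
proof (rule nth_equalityI)
  fix r assume "r < length (fibre_list k (\<lambda>i. (\<alpha> i + n) mod k))"
  then have r: "r < k" by (simp add: fibre_list_def)
  then have k: "0 < k" by simp
  have "(x + n) mod k = r \<longleftrightarrow> x = (k - n mod k + r) mod k" if x: "x < k" for x
  proof -
    have nk: "n mod k \<le> k" using k by (simp add: less_imp_le)
    have "(x + n) mod k = r \<longleftrightarrow> (int x + int n) mod int k = int r mod int k"
      using r by (metis mod_less of_nat_add of_nat_eq_iff of_nat_mod)
    also have "\<dots> \<longleftrightarrow> int x mod int k = (int r - int n) mod int k"
      by (simp add: mod_eq_dvd_iff algebra_simps)
    also have "(int r - int n) mod int k = int ((k - n mod k + r) mod k)"
    proof -
      have "int (k - n mod k + r) = (int r - int (n mod k)) + int k"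
        using nk by linarith
      then have "int ((k - n mod k + r) mod k) = ((int r - int (n mod k)) + int k) mod int k"
        by (metis of_nat_mod)
      also have "\<dots> = (int r - int n mod int k) mod int k"
        by (simp only: mod_add_self2 of_nat_mod)
      finally show ?thesis by (simp only: mod_diff_right_eq)
    qed
    also have "int x mod int k = int x" using x by simp
    finally show ?thesis by simp
  qed
  then have "\<alpha> i = (k - n mod k + r) mod k \<longleftrightarrow> (\<alpha> i + n) mod k = r" for i
    using assms by (metis lessThan_iff rangeI)
  then show "fibre_list k (\<lambda>i. (\<alpha> i + n) mod k) ! r = rotate (k - n mod k) (fibre_list k \<alpha>) ! r"
    using r k by (auto simp: fibre_list_def nth_rotate)
qed (simp add: fibre_list_def)

lemma rotate_back:
  "\<exists>m. rotate m (rotate n xs) = xs"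
proof (cases "xs = []")
  case False
  have "rotate (length xs - n mod length xs) (rotate n xs) = rotate (length xs - n mod length xs + n) xs"
    by (simp add: rotate_rotate)
  also have "(length xs - n mod length xs + n) mod length xs = 0"
  proof -
    have "(length xs - n mod length xs + n mod length xs) mod length xs = 0"
      using False by (simp add: less_imp_le)
    then show ?thesis by (simp add: mod_add_right_eq)
  qed
  then have "rotate (length xs - n mod length xs + n) xs = xs"
    by (simp add: rotate_id)
  finally show ?thesis by blast
qed simp

lemma cyclic_class_eq_iff: "cyclic_class xs = cyclic_class ys \<longleftrightarrow> (\<exists>n. ys = rotate n xs)"
proof
  assume "cyclic_class xs = cyclic_class ys"
  moreover have "ys = rotate 0 ys" by simp
  then have "ys \<in> cyclic_class ys" unfolding cyclic_class_def by blast
  ultimately show "\<exists>n. ys = rotate n xs" by (auto simp: cyclic_class_def)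
next
  assume "\<exists>n. ys = rotate n xs"
  then obtain n m where "ys = rotate n xs" "xs = rotate m ys"
    using rotate_back by metis
  then show "cyclic_class xs = cyclic_class ys"
    unfolding cyclic_class_def by (auto simp: rotate_rotate) (metis rotate_rotate)+
qed

text \<open>Rotations of a distinct list by different amounts below its length already differ in
  their first entry.\<close>

lemma card_cyclic_class:
  assumes "distinct xs" "xs \<noteq> []"
  shows "card (cyclic_class xs) = length xs"
proof -
  have "cyclic_class xs = (\<lambda>n. rotate n xs) ` {..<length xs}"
  proof -
    have "rotate n xs \<in> (\<lambda>n. rotate n xs) ` {..<length xs}" for n
      using assms(2) by (subst rotate_conv_mod) auto
    then show ?thesis by (auto simp: cyclic_class_def)
  qed
  moreover have "inj_on (\<lambda>n. rotate n xs) {..<length xs}"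
  proof (rule inj_onI)
    fix m n assume mn: "m \<in> {..<length xs}" "n \<in> {..<length xs}" "rotate m xs = rotate n xs"
    then have "xs ! m = xs ! n"
      using nth_rotate[of 0 xs m] nth_rotate[of 0 xs n] assms(2) by simp
    then show "m = n"
      using mn assms(1) by (simp add: nth_eq_iff_index_eq)
  qed
  ultimately show ?thesis by (simp add: card_image)
qed

text \<open>The cyclic classes partition the pair lists into blocks of size \<open>k\<close>; the
  pairs of a list are distinct because their first components are.\<close>

lemma card_pair_collections:
  assumes "1 \<le> k"
  shows "k * card (pair_collections k :: ('d::finite set \<times> 'l::finite set) list set set)
    = card (pair_lists k :: ('d set \<times> 'l set) list set)"
proof -
  have rot: "rotate n xs \<in> pair_lists k" if "xs \<in> pair_lists k" for n and xs :: "('d set \<times> 'l set) list"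
    using that by (simp add: pair_lists_def is_partition_def rotate_map[symmetric])
  have Un: "\<Union>(pair_collections k) = (pair_lists k :: ('d set \<times> 'l set) list set)"
  proof
    show "\<Union>(pair_collections k) \<subseteq> (pair_lists k :: ('d set \<times> 'l set) list set)"
      using rot by (auto simp: pair_collections_def cyclic_class_def)
    show "(pair_lists k :: ('d set \<times> 'l set) list set) \<subseteq> \<Union>(pair_collections k)"
    proof
      fix xs :: "('d set \<times> 'l set) list"
      assume "xs \<in> pair_lists k"
      moreover have "xs = rotate 0 xs" by simp
      then have "xs \<in> cyclic_class xs" unfolding cyclic_class_def by blast
      ultimately show "xs \<in> \<Union>(pair_collections k)" by (auto simp: pair_collections_def)
    qed
  qed
  have "k * card (pair_collections k :: ('d set \<times> 'l set) list set set)
      = card (\<Union>(pair_collections k) :: ('d set \<times> 'l set) list set)"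
  proof (rule card_partition)
    show "finite (pair_collections k :: ('d set \<times> 'l set) list set set)"
      by (simp add: pair_collections_def finite_pair_lists)
    show "finite (\<Union>(pair_collections k) :: ('d set \<times> 'l set) list set)"
      by (simp add: Un finite_pair_lists)
    show "card c = k" if c: "c \<in> pair_collections k" for c :: "('d set \<times> 'l set) list set"
    proof -
      obtain xs where xs: "xs \<in> pair_lists k" "c = cyclic_class xs"
        using c by (auto simp: pair_collections_def)
      then have "length xs = k" "distinct xs"
        by (auto simp: pair_lists_def is_partition_def distinct_map)
      moreover from this have "xs \<noteq> []" using assms by auto
      ultimately show ?thesis using card_cyclic_class xs(2) by blast
    qed
    show "c \<inter> d = {}" if cd: "c \<in> pair_collections k" "d \<in> pair_collections k" "c \<noteq> d"
      for c d :: "('d set \<times> 'l set) list set"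
    proof (rule ccontr)
      assume "c \<inter> d \<noteq> {}"
      then obtain zs where zs: "zs \<in> c" "zs \<in> d" by blast
      obtain xs ys where xy: "c = cyclic_class xs" "d = cyclic_class ys"
        using cd(1,2) by (auto simp: pair_collections_def)
      with zs obtain m n where "zs = rotate m xs" "zs = rotate n ys"
        unfolding cyclic_class_def by blast
      then have "cyclic_class xs = cyclic_class zs" "cyclic_class ys = cyclic_class zs"
        unfolding cyclic_class_eq_iff by blast+
      then show False using cd(3) xy by simp
    qed
  qed
  then show ?thesis by (simp add: Un)
qed

definition labelled_pairs :: "nat \<Rightarrow> ('d \<Rightarrow> nat) \<Rightarrow> ('l \<Rightarrow> nat) \<Rightarrow> ('d set \<times> 'l set) list" where
  "labelled_pairs k \<alpha> \<beta> = zip (fibre_list k \<alpha>) (fibre_list k \<beta>)"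

lemma length_fibre_list [simp]: "length (fibre_list k \<alpha>) = k"
  by (simp add: fibre_list_def)

lemma pair_lists_eq_labelled_pairs:
  "pair_lists k = {labelled_pairs k \<alpha> \<beta> |\<alpha> \<beta>. labelling k \<alpha> \<beta>}"
proof (intro equalityI subsetI)
  fix xs :: "('a set \<times> 'b set) list"
  assume "xs \<in> pair_lists k"
  then obtain \<alpha> \<beta> where "map fst xs = fibre_list k \<alpha>" "range \<alpha> = {..<k}"
      "map snd xs = fibre_list k \<beta>" "range \<beta> = {..<k}"
    unfolding pair_lists_eq ordered_partitions_UNIV by blast
  moreover from this have "xs = labelled_pairs k \<alpha> \<beta>"
    using zip_map_fst_snd[of xs] by (simp add: labelled_pairs_def)
  ultimately show "xs \<in> {labelled_pairs k \<alpha> \<beta> |\<alpha> \<beta>. labelling k \<alpha> \<beta>}"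
    by (auto simp: labelling_def)
next
  fix xs :: "('a set \<times> 'b set) list"
  assume "xs \<in> {labelled_pairs k \<alpha> \<beta> |\<alpha> \<beta>. labelling k \<alpha> \<beta>}"
  then show "xs \<in> pair_lists k"
    unfolding pair_lists_eq ordered_partitions_UNIV
    by (auto simp: labelled_pairs_def labelling_def)
qed

lemma labelled_pairs_inj:
  assumes "labelling k \<alpha> \<beta>" "labelled_pairs k \<alpha> \<beta> = labelled_pairs k \<alpha>' \<beta>'"
  shows "\<alpha> = \<alpha>'" "\<beta> = \<beta>'"
proof -
  have "fibre_list k \<alpha> = fibre_list k \<alpha>'" "fibre_list k \<beta> = fibre_list k \<beta>'"
    using arg_cong[OF assms(2), of "map fst"] arg_cong[OF assms(2), of "map snd"]
    by (simp_all add: labelled_pairs_def)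
  then show "\<alpha> = \<alpha>'" "\<beta> = \<beta>'"
    using assms(1) fibre_list_inj unfolding labelling_def by blast+
qed

lemma rotate_labelled_pairs:
  assumes "labelling k \<alpha> \<beta>"
  shows "labelled_pairs k (\<lambda>i. (\<alpha> i + n) mod k) (\<lambda>j. (\<beta> j + n) mod k)
    = rotate (k - n mod k) (labelled_pairs k \<alpha> \<beta>)"
proof -
  have "map fst (rotate m (labelled_pairs k \<alpha> \<beta>)) = rotate m (fibre_list k \<alpha>)"
    "map snd (rotate m (labelled_pairs k \<alpha> \<beta>)) = rotate m (fibre_list k \<beta>)" for m
    by (simp_all add: labelled_pairs_def rotate_map[symmetric])
  then have "rotate m (labelled_pairs k \<alpha> \<beta>) = zip (rotate m (fibre_list k \<alpha>)) (rotate m (fibre_list k \<beta>))" for m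
    by (metis zip_map_fst_snd)
  then show ?thesis
    using assms by (simp add: labelled_pairs_def labelling_def rotate_fibre_list)
qed

text \<open>Both equations say that the labellings differ by a rotation of the labels.\<close>

lemma split_of_eq_iff_cyclic_class_eq:
  assumes k: "2 \<le> k" and lab: "labelling k \<alpha> \<beta>" "labelling k \<alpha>' \<beta>'"
  shows "split_of k \<alpha> \<beta> = split_of k \<alpha>' \<beta>' \<longleftrightarrow>
    cyclic_class (labelled_pairs k \<alpha> \<beta>) = cyclic_class (labelled_pairs k \<alpha>' \<beta>')"
proof
  assume "split_of k \<alpha> \<beta> = split_of k \<alpha>' \<beta>'"
  then obtain n where "\<alpha>' = (\<lambda>i. (\<alpha> i + n) mod k)" "\<beta>' = (\<lambda>j. (\<beta> j + n) mod k)"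
    using split_of_eq_imp_rotate[OF k lab] by blast
  then show "cyclic_class (labelled_pairs k \<alpha> \<beta>) = cyclic_class (labelled_pairs k \<alpha>' \<beta>')"
    using rotate_labelled_pairs[OF lab(1)] unfolding cyclic_class_eq_iff by blast
next
  assume "cyclic_class (labelled_pairs k \<alpha> \<beta>) = cyclic_class (labelled_pairs k \<alpha>' \<beta>')"
  then obtain n where n: "labelled_pairs k \<alpha>' \<beta>' = rotate n (labelled_pairs k \<alpha> \<beta>)"
    unfolding cyclic_class_eq_iff by blast
  \<comment> \<open>A shift of the labels by \<open>m\<close> rotates the list by
    \<open>k - m mod k\<close>, which is \<open>n\<close> modulo \<open>k\<close>, also when
    \<open>n mod k = 0\<close> and \<open>m = k\<close>.\<close>
  define m where "m = k - n mod k"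
  have "k - m mod k = n mod k \<or> m mod k = 0 \<and> n mod k = 0"
    using k by (cases "n mod k = 0") (auto simp: m_def)
  then have "(k - m mod k) mod k = n mod k" by auto
  then have "rotate n (labelled_pairs k \<alpha> \<beta>) = rotate (k - m mod k) (labelled_pairs k \<alpha> \<beta>)"
    by (metis labelled_pairs_def length_fibre_list length_zip min.idem rotate_conv_mod)
  then have "labelled_pairs k \<alpha>' \<beta>' = labelled_pairs k (\<lambda>i. (\<alpha> i + m) mod k) (\<lambda>j. (\<beta> j + m) mod k)"
    using n rotate_labelled_pairs[OF lab(1), of m] by simp
  then have "\<alpha>' = (\<lambda>i. (\<alpha> i + m) mod k)" "\<beta>' = (\<lambda>j. (\<beta> j + m) mod k)"
    using labelled_pairs_inj[OF lab(2)] by blast+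
  then show "split_of k \<alpha> \<beta> = split_of k \<alpha>' \<beta>'"
    using labelling.split_of_rotate[OF lab(1)] by simp
qed

section \<open>The bijection and the count\<close>

lemma k_splits_eq:
  assumes "2 \<le> k"
  shows "{S. k_split k S simplex_product} = (\<lambda>(\<alpha>, \<beta>). split_of k \<alpha> \<beta>) ` {(\<alpha>, \<beta>). labelling k \<alpha> \<beta>}"
  using k_split_imp_split labelling.k_split_split[OF _ assms] by fast

lemma pair_collections_eq:
  "pair_collections k = (\<lambda>(\<alpha>, \<beta>). cyclic_class (labelled_pairs k \<alpha> \<beta>)) ` {(\<alpha>, \<beta>). labelling k \<alpha> \<beta>}"
  unfolding pair_collections_def pair_lists_eq_labelled_pairs by auto

text \<open>Splits and collections are both images of the set of labellings; maps with the same
  fibres have images in bijection.\<close>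

lemma ex_bij_betw_images:
  assumes "\<And>x y. x \<in> A \<Longrightarrow> y \<in> A \<Longrightarrow> f x = f y \<longleftrightarrow> g x = g y"
  shows "\<exists>h. bij_betw h (f ` A) (g ` A)"
proof
  have h: "g (inv_into A f (f x)) = g x" if "x \<in> A" for x
    using assms[of "inv_into A f (f x)" x] that inv_into_into[of "f x" f A] f_inv_into_f[of "f x" f A]
    by simp
  show "bij_betw (\<lambda>z. g (inv_into A f z)) (f ` A) (g ` A)"
    unfolding bij_betw_def
  proof
    show "inj_on (\<lambda>z. g (inv_into A f z)) (f ` A)"
    proof (rule inj_onI, elim imageE)
      fix z z' x y
      assume "z = f x" "x \<in> A" "z' = f y" "y \<in> A" "g (inv_into A f z) = g (inv_into A f z')"
      then show "z = z'" using h[of x] h[of y] assms[of x y] by metis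
    qed
    show "(\<lambda>z. g (inv_into A f z)) ` f ` A = g ` A"
      unfolding image_image by (rule image_cong) (simp_all add: h)
  qed
qed

theorem theorem32:
  fixes k :: nat
  assumes "k \<ge> 2"
  shows "(\<exists>f. bij_betw f
            {S. k_split k S (simplex_product :: ((real ^ 'd) \<times> (real ^ 'l)) set)}
            (pair_collections k :: ('d set \<times> 'l set) list set set))
       \<and> finite {S. k_split k S (simplex_product :: ((real ^ 'd) \<times> (real ^ 'l)) set)}
       \<and> real (card {S. k_split k S (simplex_product :: ((real ^ 'd) \<times> (real ^ 'l)) set)})
           = 1 / real k * real (iterated_binomial_sum CARD('d) k)
                        * real (iterated_binomial_sum CARD('l) k)"
proof -
  let ?S = "{S. k_split k S (simplex_product :: ((real ^ 'd) \<times> (real ^ 'l)) set)}"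
  let ?C = "pair_collections k :: ('d set \<times> 'l set) list set set"
  have "\<exists>f. bij_betw f ?S ?C"
    unfolding k_splits_eq[OF assms] pair_collections_eq
    by (rule ex_bij_betw_images) (simp add: split_beta split_of_eq_iff_cyclic_class_eq[OF assms])
  then obtain f where f: "bij_betw f ?S ?C" by blast
  have "finite ?C"
    by (simp add: pair_collections_def finite_pair_lists)
  then have fin: "finite ?S" using bij_betw_finite[OF f] by blast
  have pos: "1 \<le> CARD('d)" "1 \<le> CARD('l)"
    by (simp_all add: Suc_le_eq)
  have "k * card ?S = iterated_binomial_sum CARD('d) k * iterated_binomial_sum CARD('l) k"
    using card_pair_collections[where 'd = 'd and 'l = 'l, of k] bij_betw_same_card[OF f] assms
      iterated_binomial_sum_eq_count[of k] pos by (simp add: card_pair_lists)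
  then have "real k * real (card ?S)
      = real (iterated_binomial_sum CARD('d) k) * real (iterated_binomial_sum CARD('l) k)"
    by (metis of_nat_mult)
  then have "real (card ?S) = 1 / real k * real (iterated_binomial_sum CARD('d) k)
                        * real (iterated_binomial_sum CARD('l) k)"
    using assms by (simp add: field_simps)
  with f fin show ?thesis by blast
qed

end
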